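(* Let $X$ be a finite-dimensional real vector space with $\dim X>1$, equipped with a topology $\tau$, and let $\mathcal{A}_X$ be a $\rho$-admissible subset of $X$ such that $\mathcal{A}=\mathcal{A}_X\cup(-\mathcal{A}_X)$ is compact in $(X,\tau)$. Let $Y$ be a real vector space with the topology $\Gamma$ generated by a finite family $\{p_i\}_{i=1}^m$ of non-trivial semi-norms, and let $\mathcal{A}_Y$ be a $\rho$-admissible subset of $Y$ such that $\max_{1\le i\le m}p_i(b)\in\{0,1\}$ for every $b\in\mathcal{A}_Y\cup(-\mathcal{A}_Y)$. Let $P$ be the semi-norm on $\mathbb{L}(X,Y)$ induced by $\{p_i\}_{i=1}^m$, and let $\mathbb{A}_{\mathbb{L}(X,Y)}$ be a $\rho$-admissible subset of $\mathbb{L}(X,Y)$ such that $P(S)\in\{0,1\}$ for every $S\in\mathbb{A}_{\mathbb{L}(X,Y)}\cup(-\mathbb{A}_{\mathbb{L}(X,Y)})$. Let $T,A\in\mathbb{L}(X,Y)$ with $P(T)\neq 0$. Then $$T\perp_{(P,\,\mathcal{S}_{\mathbb{L}(X,Y)^*},\,\mathbb{A}_{\mathbb{L}(X,Y)})}A$$ if and only if there exist $x,y\in\mathcal{M}_T$ and $p,q\in\mathcal{P}_T$ such that $p(Tx)=q(Ty)=P(T)$, $Ax\in (Tx)^{\oplus_p}$ and $Ay\in (Ty)^{\ominus_q}$.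
   Context: Projective relation on a real vector space $Z$: for $u,v\in Z\setminus\{0\}$, $u\,\rho\,v$ iff $u=tv$ for some non-zero $t\in\mathbb{R}$. A subset $\mathcal{A}_Z\subset Z$ is $\rho$-admissible if it consists of exactly one element from each equivalence class of $\rho$; for non-zero $x\in Z$, $a_x$ denotes the unique element of $\mathcal{A}_Z$ equivalent to $x$. Orthogonality: let $\sigma$ be a topology on $Z$, $\mathcal{F}$ a family of continuous functions $(Z,\sigma)\to\mathbb{R}$, and $\mathcal{A}_Z$ a $\rho$-admissible set. For $u,v\in\mathcal{A}_Z$, $u\perp_{(\sigma,\mathcal{F},\mathcal{A}_Z)}v$ means that there is $f\in\mathcal{F}$ with $f(u)=\sup_{z\in\mathcal{A}_Z}|f(z)|$ and $f(\lambda v)=0$ for all $\lambda\in\mathbb{R}$. For non-zero $x,y\in Z$, $x\perp_{(\sigma,\mathcal{F},\mathcal{A}_Z)}y$ means $a_x\perp_{(\sigma,\mathcal{F},\mathcal{A}_Z)}a_y$. If $x=0$ or $y=0$, then $x\perp_{(\sigma,\mathcal{F},\mathcal{A}_Z)}y$ holds by definition. The vector space operations of $X$ need not be $\tau$-continuous. A semi-norm $p_i$ is non-trivial if $p_i(y_i)\ne0$ for some $y_i\in Y$. The topology $\Gamma$ has as open sets all unions of translates of finite intersections of the sets $\{y\in Y:p(y)<1/n\}$, $p\in\{p_i\}_{i=1}^m$, $n\in\mathbb{N}$, $n\geq 1$ (it need not be Hausdorff). $\mathbb{L}(X,Y)$ is the vector space of all continuous linear maps $(X,\tau)\to(Y,\Gamma)$.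 The induced semi-norm is $P(T)=\max_i\max_{a\in\mathcal{A}}p_i(T(a))$. $\mathbb{L}(X,Y)$ carries the topology generated (in the same way) by the single semi-norm $P$; this topology is also denoted by $P$ in the subscript of $\perp$. $\mathcal{M}_T=\{a\in\mathcal{A}:P(T)=p(T(a))\text{ for some }p\in\{p_i\}_{i=1}^m\}$ and $\mathcal{P}_T=\{p\in\{p_i\}_{i=1}^m:P(T)=p(T(a))\text{ for some }a\in\mathcal{A}\}$. $\mathcal{S}_{\mathbb{L}(X,Y)^*}$ is the set of all linear functionals $F:\mathbb{L}(X,Y)\to\mathbb{R}$ such that $|F(S)|\le P(S)$ for all $S\in\mathbb{L}(X,Y)$ and $F(R)=1$ for some $R\in\mathbb{A}_{\mathbb{L}(X,Y)}\cup(-\mathbb{A}_{\mathbb{L}(X,Y)})$ with $P(R)=1$. For $b\in\mathcal{A}_Y\cup(-\mathcal{A}_Y)$ let $W_b=\{p\in\{p_i\}_{i=1}^m:p(b)=1\}$. Let $w\in Y$ be non-zero, let $b_w$ be the element of $\mathcal{A}_Y$ equivalent to $w$, write $w=\mu b_w$, and let $p\in W_{b_w}$. Call a linear functional $f:Y\to\mathbb{R}$ a $(p,b_w)$-functional if $|f(z)|\le p(z)$ for all $z\in Y$ and $f(b_w)=1$ (so that $f(b_w)=\sup_{z\in\mathcal{A}_Y}|f(z)|$). For $v\in Y$: - if $\mu>0$: $v\in w^{\oplus_p}$ iff some $(p,b_w)$-functional $f$ satisfies $f(v)\ge0$; $v\in w^{\ominus_p}$ iff some $(p,b_w)$-functional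 $f$ satisfies $f(v)\le0$; - if $\mu<0$: $v\in w^{\oplus_p}$ iff some $(p,b_w)$-functional $f$ satisfies $f(v)\le0$; $v\in w^{\ominus_p}$ iff some $(p,b_w)$-functional $f$ satisfies $f(v)\ge0$. By convention, if $w=0$ then $v\in w^{\oplus_p}\cap w^{\ominus_p}$ and $w\in v^{\oplus_p}\cap v^{\ominus_p}$ for all $v\in Y$ and all $p\in\{p_i\}_{i=1}^m$. *)

theory Defs
  imports "HOL-Analysis.Analysis" "HOL-Library.Function_Algebras"
begin

text \<open>
  Pointwise real vector space structure on functions.  A space of operators between two real
  vector spaces is then a linear subspace of the function type, and the notions below are
  defined relative to a subspace \<open>Z\<close> of an ambient real vector space, so that they apply
  to it as well as to a whole type (\<open>Z = UNIV\<close>).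
\<close>

instantiation "fun" :: (type, real_vector) real_vector
begin

definition scaleR_fun :: "real \<Rightarrow> ('a \<Rightarrow> 'b) \<Rightarrow> 'a \<Rightarrow> 'b"
  where "scaleR_fun c f = (\<lambda>x. c *\<^sub>R f x)"

instance
  by standard (auto simp: scaleR_fun_def plus_fun_def algebra_simps)

end


subsection \<open>Admissible sets and orthogonality\<close>

definition proj_rel :: "'z::real_vector \<Rightarrow> 'z \<Rightarrow> bool"
  where "proj_rel u v \<longleftrightarrow> (\<exists>t. t \<noteq> 0 \<and> u = t *\<^sub>R v)"

definition rho_admissible :: "'z::real_vector set \<Rightarrow> 'z set \<Rightarrow> bool"
  where "rho_admissible Z A \<longleftrightarrow>
    A \<subseteq> Z - {0} \<and> (\<forall>x \<in> Z - {0}. \<exists>!a. a \<in> A \<and> proj_rel a x)"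

definition representative :: "'z::real_vector set \<Rightarrow> 'z \<Rightarrow> 'z"
  where "representative A x = (THE a. a \<in> A \<and> proj_rel a x)"

text \<open>
  The underlying space of \<open>\<sigma>\<close> is \<open>Z = topspace \<sigma>\<close>.  The family \<open>\<F>\<close> is meant to consist of
  functions continuous on \<open>(Z, \<sigma>)\<close>; functions are total, but only their values on \<open>Z\<close> matter.
  The clause \<open>bdd_above\<close> is needed because \<open>Sup\<close> on the reals is meaningless for unbounded
  sets.
\<close>

definition orthogonal_repr ::
    "'z::real_vector topology \<Rightarrow> ('z \<Rightarrow> real) set \<Rightarrow> 'z set \<Rightarrow> 'z \<Rightarrow> 'z \<Rightarrow> bool"
  where "orthogonal_repr \<sigma> \<F> A u v \<longleftrightarrow>
    (\<exists>f \<in> \<F>. continuous_map \<sigma> euclideanreal f \<and>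
       bdd_above ((\<lambda>z. \<bar>f z\<bar>) ` A) \<and> f u = (SUP z\<in>A. \<bar>f z\<bar>) \<and>
       (\<forall>c. f (c *\<^sub>R v) = 0))"

definition orthogonal_wrt ::
    "'z::real_vector topology \<Rightarrow> ('z \<Rightarrow> real) set \<Rightarrow> 'z set \<Rightarrow> 'z \<Rightarrow> 'z \<Rightarrow> bool"
  where "orthogonal_wrt \<sigma> \<F> A x y \<longleftrightarrow>
    x = 0 \<or> y = 0 \<or> orthogonal_repr \<sigma> \<F> A (representative A x) (representative A y)"


subsection \<open>Semi-norms and the topology they generate\<close>

definition seminorm_on :: "'z::real_vector set \<Rightarrow> ('z \<Rightarrow> real) \<Rightarrow> bool"
  where "seminorm_on Z p \<longleftrightarrow>
    (\<forall>x\<in>Z. 0 \<le> p x) \<and> (\<forall>x\<in>Z. \<forall>y\<in>Z. p (x + y) \<le> p x + p y) \<and>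
    (\<forall>c. \<forall>x\<in>Z. p (c *\<^sub>R x) = \<bar>c\<bar> * p x)"

text \<open>Translates of finite intersections of the balls \<open>{z \<in> Z. p z < 1/n}\<close>.\<close>

definition seminorm_base :: "'z::real_vector set \<Rightarrow> ('z \<Rightarrow> real) set \<Rightarrow> 'z set \<Rightarrow> bool"
  where "seminorm_base Z Ps U \<longleftrightarrow>
    (\<exists>c\<in>Z. \<exists>V. (finite intersection_of
                   (\<lambda>S. \<exists>p\<in>Ps. \<exists>n\<ge>1::nat. S = {z. p z < 1 / real n})
                 relative_to Z) V \<and>
               U = (\<lambda>z. c + z) ` V)"

definition seminorm_topology :: "'z::real_vector set \<Rightarrow> ('z \<Rightarrow> real) set \<Rightarrow> 'z topology"
  where "seminorm_topology Z Ps = topology (arbitrary union_of seminorm_base Z Ps)"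

lemma seminorm_on_zero: "seminorm_on Z p \<Longrightarrow> x \<in> Z \<Longrightarrow> p 0 = 0"
  unfolding seminorm_on_def by (metis abs_zero mult_zero_left scaleR_zero_left)

lemma seminorm_base_subset: "subspace Z \<Longrightarrow> seminorm_base Z Ps U \<Longrightarrow> U \<subseteq> Z"
  unfolding seminorm_base_def relative_to_def by (auto simp: subspace_add)

lemma seminorm_base_nbhd:
  assumes Z: "subspace Z" and sn: "\<And>p. p \<in> Ps \<Longrightarrow> seminorm_on Z p"
    and U: "seminorm_base Z Ps U" and u: "u \<in> U"
  shows "\<exists>e>0. {z\<in>Z. \<forall>p\<in>Ps. p (z - u) < e} \<subseteq> U"
proof -
  obtain c V where c: "c \<in> Z" and UV: "U = (\<lambda>z. c + z) ` V"
    and V: "(finite intersection_of (\<lambda>S. \<exists>p\<in>Ps. \<exists>n\<ge>1::nat. S = {z. p z < 1 / real n})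
              relative_to Z) V"
    using U unfolding seminorm_base_def by blast
  then obtain \<U> where fin: "finite \<U>" and VU: "V = Z \<inter> \<Inter>\<U>"
    and sub: "\<And>S. S \<in> \<U> \<Longrightarrow> \<exists>p\<in>Ps. \<exists>n\<ge>1::nat. S = {z. p z < 1 / real n}"
    unfolding relative_to_def intersection_of_def by blast
  have uc: "u - c \<in> V" using u UV by auto
  then have uZ: "u - c \<in> Z" using VU by auto
  have "\<exists>e>0. \<forall>z\<in>Z. (\<forall>p\<in>Ps. p (z - u) < e) \<longrightarrow> z - c \<in> S" if S: "S \<in> \<U>" for S
  proof -
    obtain p n where p: "p \<in> Ps" "S = {z. p z < 1 / real n}" using sub[OF S] by blast
    have lt: "p (u - c) < 1 / real n" using uc VU S p by auto
    show ?thesis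
    proof (intro exI[of _ "1 / real n - p (u - c)"] conjI ballI impI)
      show "0 < 1 / real n - p (u - c)" using lt by simp
      fix z assume z: "z \<in> Z" "\<forall>p'\<in>Ps. p' (z - u) < 1 / real n - p (u - c)"
      have "u \<in> Z" using uZ c subspace_add[OF Z uZ c] by simp
      then have "z - u \<in> Z" using z Z by (simp add: subspace_diff)
      then have "p ((z - u) + (u - c)) \<le> p (z - u) + p (u - c)"
        using sn[OF p(1)] uZ unfolding seminorm_on_def by blast
      moreover have "p (z - u) < 1 / real n - p (u - c)" using z p by blast
      ultimately show "z - c \<in> S" using p by simp
    qed
  qed
  then obtain E where E: "\<And>S. S \<in> \<U> \<Longrightarrow> E S > (0::real)"
    "\<And>S z. \<lbrakk>S \<in> \<U>; z \<in> Z; \<forall>p\<in>Ps. p (z - u) < E S\<rbrakk> \<Longrightarrow> z - c \<in> S" by metis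
  define e where "e = Min (insert 1 (E ` \<U>))"
  have "e > 0" unfolding e_def using fin E by auto
  moreover have "e \<le> E S" if "S \<in> \<U>" for S unfolding e_def using fin that by auto
  then have "z \<in> U" if z: "z \<in> Z" "\<forall>p\<in>Ps. p (z - u) < e" for z
  proof -
    have "z - c \<in> S" if "S \<in> \<U>" for S
      using E(2)[OF that z(1)] z(2) \<open>\<And>S. S \<in> \<U> \<Longrightarrow> e \<le> E S\<close>[OF that]
      by (meson less_le_trans)
    then have "z - c \<in> V" using VU z c Z by (auto simp: subspace_diff)
    then show ?thesis using UV by (auto intro: image_eqI[of _ _ "z - c"])
  qed
  ultimately show ?thesis by blast
qed

lemma seminorm_ball_base:
  assumes Z: "subspace Z" and Ps: "finite Ps" and u: "u \<in> Z" and n: "n \<ge> (1::nat)"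
  shows "seminorm_base Z Ps {z\<in>Z. \<forall>p\<in>Ps. p (z - u) < 1 / real n}"
  unfolding seminorm_base_def
proof (intro bexI[OF _ u] exI conjI)
  let ?V = "Z \<inter> \<Inter> ((\<lambda>p. {z. p z < 1 / real n}) ` Ps)"
  show "(finite intersection_of (\<lambda>S. \<exists>p\<in>Ps. \<exists>n\<ge>1::nat. S = {z. p z < 1 / real n})
          relative_to Z) ?V"
    unfolding relative_to_def intersection_of_def using Ps n
    by (intro exI[of _ "\<Inter> ((\<lambda>p. {z. p z < 1 / real n}) ` Ps)"] conjI refl
              exI[of _ "(\<lambda>p. {z. p z < 1 / real n}) ` Ps"]) auto
  show "{z\<in>Z. \<forall>p\<in>Ps. p (z - u) < 1 / real n} = (\<lambda>z. u + z) ` ?V"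
  proof (intro set_eqI iffI)
    fix z assume "z \<in> {z\<in>Z. \<forall>p\<in>Ps. p (z - u) < 1 / real n}"
    then show "z \<in> (\<lambda>z. u + z) ` ?V"
      using Z u by (intro image_eqI[of _ _ "z - u"]) (auto simp: subspace_diff)
  qed (use Z u in \<open>auto simp: subspace_add\<close>)
qed

lemma union_of_seminorm_base_iff:
  assumes Z: "subspace Z" and Ps: "finite Ps" and sn: "\<And>p. p \<in> Ps \<Longrightarrow> seminorm_on Z p"
  shows "(arbitrary union_of seminorm_base Z Ps) U \<longleftrightarrow>
         U \<subseteq> Z \<and> (\<forall>u\<in>U. \<exists>e>0. {z\<in>Z. \<forall>p\<in>Ps. p (z - u) < e} \<subseteq> U)"
proof
  assume "(arbitrary union_of seminorm_base Z Ps) U"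
  then obtain \<U> where U: "U = \<Union>\<U>" and b: "\<And>S. S \<in> \<U> \<Longrightarrow> seminorm_base Z Ps S"
    unfolding union_of_def by blast
  have "U \<subseteq> Z" using seminorm_base_subset[OF Z b] U by blast
  moreover have "\<exists>e>0. {z\<in>Z. \<forall>p\<in>Ps. p (z - u) < e} \<subseteq> U" if u: "u \<in> U" for u
  proof -
    obtain S where S: "S \<in> \<U>" "u \<in> S" using u U by blast
    then obtain e where "e > 0" "{z\<in>Z. \<forall>p\<in>Ps. p (z - u) < e} \<subseteq> S"
      using seminorm_base_nbhd[OF Z sn b[OF S(1)] S(2)] by blast
    then show ?thesis using S U by blast
  qed
  ultimately show "U \<subseteq> Z \<and> (\<forall>u\<in>U. \<exists>e>0. {z\<in>Z. \<forall>p\<in>Ps. p (z - u) < e} \<subseteq> U)" by blast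
next
  assume R: "U \<subseteq> Z \<and> (\<forall>u\<in>U. \<exists>e>0. {z\<in>Z. \<forall>p\<in>Ps. p (z - u) < e} \<subseteq> U)"
  have "\<exists>S. seminorm_base Z Ps S \<and> u \<in> S \<and> S \<subseteq> U" if u: "u \<in> U" for u
  proof -
    have uZ: "u \<in> Z" using R u by blast
    obtain e where e: "e > 0" "{z\<in>Z. \<forall>p\<in>Ps. p (z - u) < e} \<subseteq> U" using R u by blast
    obtain n where n: "n \<ge> (1::nat)" "1 / real n < e"
      using e(1) nat_approx_posE[of e] by (metis Suc_le_eq One_nat_def zero_less_Suc)
    let ?S = "{z\<in>Z. \<forall>p\<in>Ps. p (z - u) < 1 / real n}"
    have "?S \<subseteq> {z\<in>Z. \<forall>p\<in>Ps. p (z - u) < e}" using n(2) by force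
    moreover have "u \<in> ?S"
    proof -
      have "p (u - u) < 1 / real n" if "p \<in> Ps" for p
        using seminorm_on_zero[OF sn[OF that] uZ] n(1) by simp
      then show ?thesis using uZ by blast
    qed
    ultimately show ?thesis using seminorm_ball_base[OF Z Ps uZ n(1)] e(2) by blast
  qed
  then obtain S where "\<And>u. u \<in> U \<Longrightarrow> seminorm_base Z Ps (S u) \<and> u \<in> S u \<and> S u \<subseteq> U" by metis
  then show "(arbitrary union_of seminorm_base Z Ps) U"
    unfolding union_of_def arbitrary_def by (intro exI[of _ "S ` U"]) auto
qed

lemma openin_seminorm_topology:
  assumes Z: "subspace Z" and Ps: "finite Ps" and sn: "\<And>p. p \<in> Ps \<Longrightarrow> seminorm_on Z p"
  shows "openin (seminorm_topology Z Ps) U \<longleftrightarrow> (arbitrary union_of seminorm_base Z Ps) U"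
proof -
  have "istopology (arbitrary union_of seminorm_base Z Ps)"
    unfolding istopology_base_alt
  proof (intro allI impI)
    fix S T
    assume "(arbitrary union_of seminorm_base Z Ps) S \<and>
            (arbitrary union_of seminorm_base Z Ps) T"
    then have ST: "S \<subseteq> Z" "T \<subseteq> Z"
      "\<And>u. u \<in> S \<Longrightarrow> \<exists>e>0. {z\<in>Z. \<forall>p\<in>Ps. p (z - u) < e} \<subseteq> S"
      "\<And>u. u \<in> T \<Longrightarrow> \<exists>e>0. {z\<in>Z. \<forall>p\<in>Ps. p (z - u) < e} \<subseteq> T"
      unfolding union_of_seminorm_base_iff[OF Z Ps sn, simplified] by blast+
    have "\<exists>e>0. {z\<in>Z. \<forall>p\<in>Ps. p (z - u) < e} \<subseteq> S \<inter> T" if u: "u \<in> S \<inter> T" for u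
    proof -
      obtain d e where "d > 0" "e > 0" "{z\<in>Z. \<forall>p\<in>Ps. p (z - u) < d} \<subseteq> S"
        "{z\<in>Z. \<forall>p\<in>Ps. p (z - u) < e} \<subseteq> T" using ST u by blast
      then show ?thesis by (intro exI[of _ "min d e"]) auto
    qed
    then show "(arbitrary union_of seminorm_base Z Ps) (S \<inter> T)"
      unfolding union_of_seminorm_base_iff[OF Z Ps sn, simplified] using ST by blast
  qed
  then show ?thesis unfolding seminorm_topology_def by (simp add: topology_inverse')
qed

lemma topspace_seminorm_topology:
  assumes Z: "subspace Z" and Ps: "finite Ps" and sn: "\<And>p. p \<in> Ps \<Longrightarrow> seminorm_on Z p"
  shows "topspace (seminorm_topology Z Ps) = Z"
proof -
  have op: "openin (seminorm_topology Z Ps) U \<longleftrightarrow>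
      U \<subseteq> Z \<and> (\<forall>u\<in>U. \<exists>e>0. {z\<in>Z. \<forall>p\<in>Ps. p (z - u) < e} \<subseteq> U)" for U
    unfolding openin_seminorm_topology[OF Z Ps sn, simplified]
      union_of_seminorm_base_iff[OF Z Ps sn, simplified] ..
  have "openin (seminorm_topology Z Ps) Z" unfolding op by (auto intro: exI[of _ 1])
  then show ?thesis using op by (meson openin_subset openin_topspace subset_antisym)
qed


subsection \<open>The space of continuous linear operators and its semi-norm\<close>

definition cont_lin_maps ::
    "'x::real_vector topology \<Rightarrow> 'y::real_vector topology \<Rightarrow> ('x \<Rightarrow> 'y) set"
  where "cont_lin_maps \<tau> \<Gamma> = {T. linear T \<and> continuous_map \<tau> \<Gamma> T}"

text \<open>
  The inner maximum is over an infinite set, for which \<open>Max\<close> is unspecified; when \<open>A\<close>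
  is compact and nonempty and \<open>T\<close> is continuous, the supremum below is attained
  (lemma \<open>induced_seminorm_attained\<close>).
\<close>

definition induced_seminorm ::
    "'x set \<Rightarrow> ('y \<Rightarrow> real) set \<Rightarrow> ('x \<Rightarrow> 'y) \<Rightarrow> real"
  where "induced_seminorm A Ps T = (MAX p\<in>Ps. SUP a\<in>A. p (T a))"

definition norming_points ::
    "'x set \<Rightarrow> ('y \<Rightarrow> real) set \<Rightarrow> ('x \<Rightarrow> 'y) \<Rightarrow> 'x set"
  where "norming_points A Ps T = {a\<in>A. \<exists>p\<in>Ps. induced_seminorm A Ps T = p (T a)}"

definition norming_seminorms ::
    "'x set \<Rightarrow> ('y \<Rightarrow> real) set \<Rightarrow> ('x \<Rightarrow> 'y) \<Rightarrow> ('y \<Rightarrow> real) set"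
  where "norming_seminorms A Ps T = {p\<in>Ps. \<exists>a\<in>A. induced_seminorm A Ps T = p (T a)}"

definition linear_functional_on :: "'z::real_vector set \<Rightarrow> ('z \<Rightarrow> real) \<Rightarrow> bool"
  where "linear_functional_on Z F \<longleftrightarrow>
    (\<forall>x\<in>Z. \<forall>y\<in>Z. F (x + y) = F x + F y) \<and> (\<forall>c. \<forall>x\<in>Z. F (c *\<^sub>R x) = c * F x)"

definition dual_sphere ::
    "'z::real_vector set \<Rightarrow> ('z \<Rightarrow> real) \<Rightarrow> 'z set \<Rightarrow> ('z \<Rightarrow> real) set"
  where "dual_sphere Z P A =
    {F. linear_functional_on Z F \<and> (\<forall>S\<in>Z. \<bar>F S\<bar> \<le> P S) \<and>
        (\<exists>R \<in> A \<union> uminus ` A. P R = 1 \<and> F R = 1)}"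

lemma continuous_map_seminorm_topology:
  assumes Z: "subspace Z" and Ps: "finite Ps" and sn: "\<And>p. p \<in> Ps \<Longrightarrow> seminorm_on Z p"
    and F: "\<And>u z. u \<in> Z \<Longrightarrow> z \<in> Z \<Longrightarrow> \<bar>F z - F u\<bar> \<le> p (z - u)" and p: "p \<in> Ps"
  shows "continuous_map (seminorm_topology Z Ps) euclideanreal F"
proof -
  note op = openin_seminorm_topology[OF Z Ps sn, simplified]
    union_of_seminorm_base_iff[OF Z Ps sn, simplified]
  have "openin (seminorm_topology Z Ps) {x\<in>Z. F x \<in> U}" if U: "open U" for U
    unfolding op
  proof (intro conjI ballI)
    fix u assume u: "u \<in> {x\<in>Z. F x \<in> U}"
    then obtain e where e: "e > 0" "\<And>r. \<bar>r - F u\<bar> < e \<Longrightarrow> r \<in> U"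
      using U unfolding open_dist dist_real_def by blast
    have "F z \<in> U" if "z \<in> Z" "p (z - u) < e" for z
      using that u F[of u z] by (intro e(2)) auto
    then show "\<exists>e>0. {z\<in>Z. \<forall>p\<in>Ps. p (z - u) < e} \<subseteq> {x\<in>Z. F x \<in> U}"
      using e(1) p by blast
  qed auto
  then show ?thesis
    using topspace_seminorm_topology[OF Z Ps sn]
    by (auto simp: continuous_map_def)
qed

lemma dual_sphere_continuous:
  assumes Z: "subspace Z" and P: "seminorm_on Z P" and F: "F \<in> dual_sphere Z P A"
  shows "continuous_map (seminorm_topology Z {P}) euclideanreal F"
proof (rule continuous_map_seminorm_topology[where p = P])
  fix u z assume uz: "u \<in> Z" "z \<in> Z"
  then have d: "z - u \<in> Z" using Z by (simp add: subspace_diff)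
  have "F ((z - u) + u) = F (z - u) + F u"
    using F d uz unfolding dual_sphere_def linear_functional_on_def by blast
  moreover have "\<bar>F (z - u)\<bar> \<le> P (z - u)" using F d unfolding dual_sphere_def by blast
  ultimately show "\<bar>F z - F u\<bar> \<le> P (z - u)" by simp
qed (use Z P in auto)

lemma cont_lin_maps_iff:
  assumes Ps: "finite Ps" and sn: "\<And>p. p \<in> Ps \<Longrightarrow> seminorm_on UNIV p"
    and \<tau>: "topspace \<tau> = UNIV"
  shows "T \<in> cont_lin_maps \<tau> (seminorm_topology UNIV Ps) \<longleftrightarrow> linear T \<and>
    (\<forall>x. \<forall>e>0. \<exists>U. openin \<tau> U \<and> x \<in> U \<and> (\<forall>z\<in>U. \<forall>p\<in>Ps. p (T z - T x) < e))"
proof -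
  note op = openin_seminorm_topology[OF subspace_UNIV Ps sn, simplified]
    union_of_seminorm_base_iff[OF subspace_UNIV Ps sn, simplified]
  note ts = topspace_seminorm_topology[OF subspace_UNIV Ps sn, simplified]
  have "continuous_map \<tau> (seminorm_topology UNIV Ps) T \<longleftrightarrow>
    (\<forall>x. \<forall>e>0. \<exists>U. openin \<tau> U \<and> x \<in> U \<and> (\<forall>z\<in>U. \<forall>p\<in>Ps. p (T z - T x) < e))"
  proof (intro iffI allI impI)
    fix x and e :: real
    assume c: "continuous_map \<tau> (seminorm_topology UNIV Ps) T" and e: "e > 0"
    obtain n where n: "n \<ge> (1::nat)" "1 / real n < e"
      using e nat_approx_posE[of e] by (metis Suc_le_eq One_nat_def zero_less_Suc)
    let ?V = "{z. \<forall>p\<in>Ps. p (z - T x) < 1 / real n}"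
    have "seminorm_base UNIV Ps ?V"
      using seminorm_ball_base[OF subspace_UNIV Ps UNIV_I n(1), of "T x"] by simp
    then have "(arbitrary union_of seminorm_base UNIV Ps) ?V"
      by (simp add: arbitrary_union_of_inc)
    then have "openin (seminorm_topology UNIV Ps) ?V"
      using openin_seminorm_topology[OF subspace_UNIV Ps sn] by blast
    then have "openin \<tau> {z \<in> topspace \<tau>. T z \<in> ?V}"
      using c openin_continuous_map_preimage by blast
    moreover have "p (T x - T x) = 0" if "p \<in> Ps" for p
      using seminorm_on_zero[OF sn[OF that], of 0] by simp
    ultimately show "\<exists>U. openin \<tau> U \<and> x \<in> U \<and> (\<forall>z\<in>U. \<forall>p\<in>Ps. p (T z - T x) < e)"
      using n \<tau> by (intro exI[of _ "{z \<in> topspace \<tau>. T z \<in> ?V}"]) force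
  next
    assume R: "\<forall>x. \<forall>e>0. \<exists>U. openin \<tau> U \<and> x \<in> U \<and> (\<forall>z\<in>U. \<forall>p\<in>Ps. p (T z - T x) < e)"
    show "continuous_map \<tau> (seminorm_topology UNIV Ps) T"
      unfolding continuous_map_def ts
    proof (intro conjI allI impI)
      fix V assume V: "openin (seminorm_topology UNIV Ps) V"
      show "openin \<tau> {x \<in> topspace \<tau>. T x \<in> V}"
      proof (subst openin_subopen, intro ballI)
        fix x assume x: "x \<in> {x \<in> topspace \<tau>. T x \<in> V}"
        obtain e where e: "e > 0" "{z. \<forall>p\<in>Ps. p (z - T x) < e} \<subseteq> V"
          using V x unfolding op by blast
        obtain U where U: "openin \<tau> U" "x \<in> U" "\<And>z p. z \<in> U \<Longrightarrow> p \<in> Ps \<Longrightarrow> p (T z - T x) < e"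
          using R e(1) by meson
        then have "U \<subseteq> {x \<in> topspace \<tau>. T x \<in> V}" using \<tau> e(2) by blast
        then show "\<exists>U. openin \<tau> U \<and> x \<in> U \<and> U \<subseteq> {x \<in> topspace \<tau>. T x \<in> V}"
          using U by blast
      qed
    qed auto
  qed
  then show ?thesis unfolding cont_lin_maps_def by simp
qed

lemma subspace_cont_lin_maps:
  fixes \<tau> :: "'x::real_vector topology" and Ps :: "('y::real_vector \<Rightarrow> real) set"
  assumes Ps: "finite Ps" and sn: "\<And>p. p \<in> Ps \<Longrightarrow> seminorm_on UNIV p"
    and \<tau>: "topspace \<tau> = UNIV"
  shows "subspace (cont_lin_maps \<tau> (seminorm_topology UNIV Ps))"
proof -
  note iff = cont_lin_maps_iff[OF Ps sn \<tau>, simplified]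
  have p0: "p 0 = 0" if "p \<in> Ps" for p using seminorm_on_zero[OF sn[OF that], of 0] by simp
  show ?thesis
    unfolding subspace_def
  proof (intro conjI ballI allI)
    show "0 \<in> cont_lin_maps \<tau> (seminorm_topology UNIV Ps)"
      unfolding iff
    proof (intro conjI allI impI)
      show "linear (0 :: 'x \<Rightarrow> 'y)" by (simp add: linear_iff)
      fix x and e :: real assume "e > 0"
      then have "p ((0 :: 'x \<Rightarrow> 'y) z - (0 :: 'x \<Rightarrow> 'y) x) < e" if "p \<in> Ps" for p z
        using p0[OF that] by simp
      then show "\<exists>U. openin \<tau> U \<and> x \<in> U \<and>
          (\<forall>z\<in>U. \<forall>p\<in>Ps. p ((0 :: 'x \<Rightarrow> 'y) z - (0 :: 'x \<Rightarrow> 'y) x) < e)"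
        using \<tau> openin_topspace[of \<tau>] by (intro exI[of _ "topspace \<tau>"]) auto
    qed
  next
    fix S T
    assume S: "S \<in> cont_lin_maps \<tau> (seminorm_topology UNIV Ps)"
      and T: "T \<in> cont_lin_maps \<tau> (seminorm_topology UNIV Ps)"
    show "S + T \<in> cont_lin_maps \<tau> (seminorm_topology UNIV Ps)"
      unfolding iff
    proof (intro conjI allI impI)
      show "linear (S + T)" using S T unfolding iff plus_fun_def by (blast intro: linear_compose_add)
      fix x and e :: real assume "e > 0"
      then have e2: "e / 2 > 0" by simp
      obtain U where U: "openin \<tau> U" "x \<in> U" "\<And>z p. z \<in> U \<Longrightarrow> p \<in> Ps \<Longrightarrow> p (S z - S x) < e/2"
        using S e2 unfolding iff by meson
      obtain V where V: "openin \<tau> V" "x \<in> V" "\<And>z p. z \<in> V \<Longrightarrow> p \<in> Ps \<Longrightarrow> p (T z - T x) < e/2"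
        using T e2 unfolding iff by meson
      have "p ((S + T) z - (S + T) x) < e" if zp: "z \<in> U \<inter> V" "p \<in> Ps" for z p
      proof -
        have "p ((S z - S x) + (T z - T x)) \<le> p (S z - S x) + p (T z - T x)"
          using sn[OF zp(2)] unfolding seminorm_on_def by blast
        moreover have "p (S z - S x) < e/2" "p (T z - T x) < e/2"
          using U(3)[of z p] V(3)[of z p] zp by blast+
        ultimately have "p ((S z - S x) + (T z - T x)) < e" by linarith
        moreover have "(S + T) z - (S + T) x = (S z - S x) + (T z - T x)"
          by (simp add: plus_fun_def)
        ultimately show ?thesis by (simp only:)
      qed
      then show "\<exists>W. openin \<tau> W \<and> x \<in> W \<and> (\<forall>z\<in>W. \<forall>p\<in>Ps. p ((S + T) z - (S + T) x) < e)"
        using U V by (intro exI[of _ "U \<inter> V"]) auto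
    qed
  next
    fix c T assume T: "T \<in> cont_lin_maps \<tau> (seminorm_topology UNIV Ps)"
    show "c *\<^sub>R T \<in> cont_lin_maps \<tau> (seminorm_topology UNIV Ps)"
      unfolding iff
    proof (intro conjI allI impI)
      show "linear (c *\<^sub>R T)"
        using T unfolding iff scaleR_fun_def by (blast intro: linear_compose_scale_right)
      fix x and e :: real assume e: "e > 0"
      have "e / (\<bar>c\<bar> + 1) > 0" using e by simp
      then obtain U where U: "openin \<tau> U" "x \<in> U"
        "\<And>z p. z \<in> U \<Longrightarrow> p \<in> Ps \<Longrightarrow> p (T z - T x) < e / (\<bar>c\<bar> + 1)"
        using T unfolding iff by meson
      have "p ((c *\<^sub>R T) z - (c *\<^sub>R T) x) < e" if zp: "z \<in> U" "p \<in> Ps" for z p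
      proof -
        have "(c *\<^sub>R T) z - (c *\<^sub>R T) x = c *\<^sub>R (T z - T x)"
          by (simp add: scaleR_fun_def algebra_simps)
        then have "p ((c *\<^sub>R T) z - (c *\<^sub>R T) x) = \<bar>c\<bar> * p (T z - T x)"
          using sn[OF zp(2)] unfolding seminorm_on_def by simp
        also have "\<dots> \<le> (\<bar>c\<bar> + 1) * p (T z - T x)"
          using sn[OF zp(2)] unfolding seminorm_on_def by (intro mult_right_mono) auto
        also have "\<dots> < e" using U(3)[OF zp] by (simp add: field_simps)
        finally show ?thesis .
      qed
      then show "\<exists>W. openin \<tau> W \<and> x \<in> W \<and>
          (\<forall>z\<in>W. \<forall>p\<in>Ps. p ((c *\<^sub>R T) z - (c *\<^sub>R T) x) < e)"
        using U by blast
    qed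
  qed
qed

lemma induced_seminorm_attained:
  assumes Ps: "finite Ps" "Ps \<noteq> {}" and sn: "\<And>p. p \<in> Ps \<Longrightarrow> seminorm_on UNIV p"
    and A: "compactin \<tau> A" "A \<noteq> {}"
    and T: "T \<in> cont_lin_maps \<tau> (seminorm_topology UNIV Ps)"
  shows "\<exists>p\<in>Ps. \<exists>a\<in>A. induced_seminorm A Ps T = p (T a)"
    and "\<And>p a. p \<in> Ps \<Longrightarrow> a \<in> A \<Longrightarrow> p (T a) \<le> induced_seminorm A Ps T"
proof -
  have cp: "continuous_map (seminorm_topology UNIV Ps) euclideanreal p" if p: "p \<in> Ps" for p
  proof (rule continuous_map_seminorm_topology[OF subspace_UNIV Ps(1) sn _ p])
    fix u z
    have "p ((z - u) + u) \<le> p (z - u) + p u" "p ((-1) *\<^sub>R (z - u) + z) \<le> p ((-1) *\<^sub>R (z - u)) + p z"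
      "p ((-1) *\<^sub>R (z - u)) = \<bar>-1\<bar> * p (z - u)"
      using sn[OF p] unfolding seminorm_on_def by blast+
    then show "\<bar>p z - p u\<bar> \<le> p (z - u)" by simp
  qed
  have cT: "continuous_map \<tau> (seminorm_topology UNIV Ps) T"
    using T unfolding cont_lin_maps_def by blast
  have K: "compact ((\<lambda>a. p (T a)) ` A)" if "p \<in> Ps" for p
    using image_compactin[OF A(1) continuous_map_compose[OF cT cp[OF that]]]
    by (simp add: o_def)
  have B: "bdd_above ((\<lambda>a. p (T a)) ` A)" if "p \<in> Ps" for p
    using K[OF that] by (simp add: bounded_imp_bdd_above compact_imp_bounded)
  have "induced_seminorm A Ps T \<in> (\<lambda>p. SUP a\<in>A. p (T a)) ` Ps"
    unfolding induced_seminorm_def using Ps by (intro Max_in) auto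
  then obtain p where p: "p \<in> Ps" "induced_seminorm A Ps T = (SUP a\<in>A. p (T a))" by blast
  have "(SUP a\<in>A. p (T a)) \<in> (\<lambda>a. p (T a)) ` A"
    using closed_contains_Sup[OF _ B[OF p(1)] compact_imp_closed[OF K[OF p(1)]]] A(2) by simp
  then show "\<exists>p\<in>Ps. \<exists>a\<in>A. induced_seminorm A Ps T = p (T a)" using p by auto
  show "p (T a) \<le> induced_seminorm A Ps T" if "p \<in> Ps" "a \<in> A" for p a
  proof -
    have "p (T a) \<le> (SUP a\<in>A. p (T a))" using B[OF that(1)] that(2) by (rule cSUP_upper2) simp
    also have "\<dots> \<le> induced_seminorm A Ps T"
      unfolding induced_seminorm_def using Ps that(1) by (intro Max_ge) auto
    finally show ?thesis .
  qed
qed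

lemma seminorm_on_induced_seminorm:
  assumes Ps: "finite Ps" "Ps \<noteq> {}" and sn: "\<And>p. p \<in> Ps \<Longrightarrow> seminorm_on UNIV p"
    and A: "compactin \<tau> A" "A \<noteq> {}" and \<tau>: "topspace \<tau> = UNIV"
  shows "seminorm_on (cont_lin_maps \<tau> (seminorm_topology UNIV Ps)) (induced_seminorm A Ps)"
proof -
  let ?L = "cont_lin_maps \<tau> (seminorm_topology UNIV Ps)" and ?P = "induced_seminorm A Ps"
  note sub = subspace_cont_lin_maps[OF Ps(1) sn \<tau>, simplified]
  note att = induced_seminorm_attained(1)[OF Ps sn A, simplified]
  note le = induced_seminorm_attained(2)[OF Ps sn A, simplified]
  have ge0: "0 \<le> p y" and tri: "p (y + z) \<le> p y + p z" and hom: "p (c *\<^sub>R y) = \<bar>c\<bar> * p y"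
    if "p \<in> Ps" for p y z c
    using sn[OF that] unfolding seminorm_on_def by blast+
  show ?thesis
    unfolding seminorm_on_def
  proof (intro conjI ballI allI)
    fix S assume S: "S \<in> ?L"
    then show "0 \<le> ?P S" using att[OF S] ge0 by metis
    fix T assume T: "T \<in> ?L"
    obtain p a where pa: "p \<in> Ps" "a \<in> A" "?P (S + T) = p ((S + T) a)"
      using att[OF subspace_add[OF sub S T]] by blast
    then show "?P (S + T) \<le> ?P S + ?P T"
      using tri[OF pa(1), of "S a" "T a"] le[OF S pa(1,2)] le[OF T pa(1,2)]
      by (simp add: plus_fun_def)
  next
    fix c S assume S: "S \<in> ?L"
    have cS: "c *\<^sub>R S \<in> ?L" by (rule subspace_scale[OF sub S])
    obtain p a where pa: "p \<in> Ps" "a \<in> A" "?P (c *\<^sub>R S) = p ((c *\<^sub>R S) a)"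
      using att[OF cS] by blast
    obtain q b where qb: "q \<in> Ps" "b \<in> A" "?P S = q (S b)" using att[OF S] by blast
    show "?P (c *\<^sub>R S) = \<bar>c\<bar> * ?P S"
    proof (rule antisym)
      show "?P (c *\<^sub>R S) \<le> \<bar>c\<bar> * ?P S"
        using pa hom[OF pa(1)] le[OF S pa(1,2)] by (simp add: scaleR_fun_def mult_left_mono)
      show "\<bar>c\<bar> * ?P S \<le> ?P (c *\<^sub>R S)"
        using le[OF cS qb(1,2)] hom[OF qb(1)] qb(3) by (simp add: scaleR_fun_def)
    qed
  qed
qed


subsection \<open>The sets \<open>w\<^sup>\<oplus>\<close> and \<open>w\<^sup>\<ominus>\<close>\<close>

definition unit_seminorms :: "('y \<Rightarrow> real) set \<Rightarrow> 'y \<Rightarrow> ('y \<Rightarrow> real) set"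
  where "unit_seminorms Ps b = {p\<in>Ps. p b = 1}"

definition pb_functional ::
    "('y::real_vector \<Rightarrow> real) set \<Rightarrow> ('y \<Rightarrow> real) \<Rightarrow> 'y \<Rightarrow> ('y \<Rightarrow> real) \<Rightarrow> bool"
  where "pb_functional Ps p b f \<longleftrightarrow>
    p \<in> unit_seminorms Ps b \<and> linear f \<and> (\<forall>z. \<bar>f z\<bar> \<le> p z) \<and> f b = 1"

text \<open>
  The disjuncts \<open>w = 0\<close> and \<open>v = 0\<close> express the convention for the zero vector.  For
  \<open>w \<noteq> 0\<close> the scalar \<open>\<mu>\<close> is unique and non-zero.
\<close>

definition oplus_set ::
    "('y::real_vector \<Rightarrow> real) set \<Rightarrow> 'y set \<Rightarrow> ('y \<Rightarrow> real) \<Rightarrow> 'y \<Rightarrow> 'y set"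
  where "oplus_set Ps A p w =
    {v. w = 0 \<or> v = 0 \<or>
        (\<exists>\<mu>. w = \<mu> *\<^sub>R representative A w \<and>
          (\<mu> > 0 \<and> (\<exists>f. pb_functional Ps p (representative A w) f \<and> f v \<ge> 0) \<or>
           \<mu> < 0 \<and> (\<exists>f. pb_functional Ps p (representative A w) f \<and> f v \<le> 0)))}"

definition ominus_set ::
    "('y::real_vector \<Rightarrow> real) set \<Rightarrow> 'y set \<Rightarrow> ('y \<Rightarrow> real) \<Rightarrow> 'y \<Rightarrow> 'y set"
  where "ominus_set Ps A p w =
    {v. w = 0 \<or> v = 0 \<or>
        (\<exists>\<mu>. w = \<mu> *\<^sub>R representative A w \<and>
          (\<mu> > 0 \<and> (\<exists>f. pb_functional Ps p (representative A w) f \<and> f v \<le> 0) \<or>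
           \<mu> < 0 \<and> (\<exists>f. pb_functional Ps p (representative A w) f \<and> f v \<ge> 0)))}"

end

theory Submission
  imports Defs
begin

text \<open>
  Since the elements of \<open>A\<^sub>L\<close> have semi-norm \<open>0\<close> or \<open>1\<close>, the orthogonality of \<open>T\<close> and \<open>A\<close> says that
  some linear functional \<open>F\<close> on \<open>L\<close> satisfies \<open>\<bar>F\<bar> \<le> P\<close>, \<open>F T = P T\<close> and \<open>F A = 0\<close>.
  Such an \<open>F\<close> forces \<open>P T \<le> P (T + c A)\<close> for all \<open>c\<close>.  By convexity, the sets where
  \<open>P T \<le> p (T a + c A a)\<close> for some \<open>p\<close> shrink as \<open>c\<close> decreases to \<open>0\<close>, so by compactness there are
  \<open>p\<close> and \<open>a\<close> with \<open>p (T a) = P T \<le> p (T a + c A a)\<close> for all \<open>c \<ge> 0\<close>; the Hahn--Banach theorem in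
  \<open>Y\<close> turns this into a functional supporting \<open>p\<close> at \<open>T a\<close> that is non-negative at \<open>A a\<close>.
  The case \<open>c \<le> 0\<close> is the same with \<open>-A\<close>.  Conversely, if \<open>g\<close> and \<open>h\<close> are such functionals for
  the points \<open>x\<close> and \<open>y\<close>, a convex combination of \<open>S \<mapsto> g (S x)\<close> and \<open>S \<mapsto> h (S y)\<close> vanishes at \<open>A\<close>.
\<close>

subsection \<open>Sublinear functionals\<close>

definition sublinear :: "('a::real_vector \<Rightarrow> real) \<Rightarrow> bool"
  where "sublinear q \<longleftrightarrow>
    (\<forall>x y. q (x + y) \<le> q x + q y) \<and> (\<forall>c\<ge>0. \<forall>x. q (c *\<^sub>R x) = c * q x)"

lemma sublinear_add: "sublinear q \<Longrightarrow> q (x + y) \<le> q x + q y"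
  and sublinear_scale: "sublinear q \<Longrightarrow> 0 \<le> c \<Longrightarrow> q (c *\<^sub>R x) = c * q x"
  unfolding sublinear_def by auto

lemma sublinear_0: "sublinear q \<Longrightarrow> q 0 = 0"
  using sublinear_scale[of q 0 0] by simp

lemma sublinear_minus: "sublinear q \<Longrightarrow> - q (- x) \<le> q x"
  using sublinear_add[of q x "- x"] sublinear_0[of q] by simp

text \<open>One inequality suffices for homogeneity: applied to \<open>inverse c\<close> and
  \<open>c *\<^sub>R x\<close> it yields the reverse one.\<close>

lemma sublinearI:
  assumes add: "\<And>x y. q (x + y) \<le> q x + q y"
    and scale: "\<And>c x. 0 < c \<Longrightarrow> q (c *\<^sub>R x) \<le> c * q x"
  shows "sublinear q"
  unfolding sublinear_def
proof (intro conjI allI impI)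
  fix c :: real and x
  assume "0 \<le> c"
  then consider "c = 0" | "0 < c" by linarith
  then show "q (c *\<^sub>R x) = c * q x"
  proof cases
    case 1
    \<comment> \<open>The factors 2 and 1/2 give \<open>q 0 \<le> 2 * q 0\<close> and
      \<open>q 0 \<le> q 0 / 2\<close>, hence both signs.\<close>
    have "q 0 = 0" using scale[of 2 0] scale[of "1/2" 0] by simp
    with 1 show ?thesis by simp
  next
    case 2
    have "q (inverse c *\<^sub>R c *\<^sub>R x) \<le> inverse c * q (c *\<^sub>R x)"
      using 2 by (intro scale) simp
    then have "c * q x \<le> q (c *\<^sub>R x)" using 2 by (simp add: field_simps)
    with scale[OF 2, of x] show ?thesis by simp
  qed
qed (rule add)

text \<open>
  For \<open>k \<le> q v\<close> this is the largest sublinear functional below \<open>q\<close> that is at most \<open>- k\<close> at \<open>- v\<close>,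
  so that every linear functional below it is at least \<open>k\<close> at \<open>v\<close>.  For smaller \<open>q v\<close> the infimum
  is over a set that is unbounded below, and meaningless.
\<close>

definition tilt :: "('a::real_vector \<Rightarrow> real) \<Rightarrow> 'a \<Rightarrow> real \<Rightarrow> 'a \<Rightarrow> real"
  where "tilt q v k z = (INF c\<in>{0..}. q (z + c *\<^sub>R v) - c * k)"

lemma tilt_greatest: "(\<And>c. 0 \<le> c \<Longrightarrow> b \<le> q (z + c *\<^sub>R v) - c * k) \<Longrightarrow> b \<le> tilt q v k z"
  unfolding tilt_def by (intro cINF_greatest) auto

context
  fixes q :: "'a::real_vector \<Rightarrow> real" and v k
  assumes q: "sublinear q" and k: "k \<le> q v"
begin

lemma tilt_lower:
  assumes "0 \<le> c"
  shows "tilt q v k z \<le> q (z + c *\<^sub>R v) - c * k"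
proof -
  \<comment> \<open>Subadditivity at \<open>d *\<^sub>R v = (z + d *\<^sub>R v) + (- z)\<close>,
    together with \<open>k \<le> q v\<close>, keeps the infimum finite.\<close>
  have "- q (- z) \<le> q (z + d *\<^sub>R v) - d * k" if "0 \<le> d" for d
    using sublinear_add[OF q, of "z + d *\<^sub>R v" "- z"] sublinear_scale[OF q that, of v]
      mult_left_mono[OF k that] by simp
  then have "bdd_below ((\<lambda>c. q (z + c *\<^sub>R v) - c * k) ` {0..})"
    by (intro bdd_belowI[of _ "- q (- z)"]) auto
  then show ?thesis unfolding tilt_def using assms by (intro cINF_lower) auto
qed

lemma tilt_le: "tilt q v k z \<le> q z"
  using tilt_lower[of 0 z] by simp

lemma tilt_minus: "tilt q v k (- v) \<le> - k"
  using tilt_lower[of 1 "- v"] sublinear_0[OF q] by simp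

text \<open>Parameters \<open>c\<close> for \<open>x\<close> and \<open>d\<close> for
  \<open>y\<close> combine to \<open>c + d\<close> for \<open>x + y\<close>, and scaling by
  \<open>c\<close> turns \<open>d\<close> into \<open>c * d\<close>; infima are then taken over one
  parameter at a time.\<close>

lemma sublinear_tilt: "sublinear (tilt q v k)"
proof (rule sublinearI)
  fix x y
  have "tilt q v k (x + y) \<le> (q (x + c *\<^sub>R v) - c * k) + (q (y + d *\<^sub>R v) - d * k)"
    if "0 \<le> c" "0 \<le> d" for c d
    using tilt_lower[of "c + d" "x + y"] that
      sublinear_add[OF q, of "x + c *\<^sub>R v" "y + d *\<^sub>R v"]
    by (simp add: algebra_simps)
  then have "tilt q v k (x + y) - (q (y + d *\<^sub>R v) - d * k) \<le> tilt q v k x" if "0 \<le> d" for d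
    using that by (intro tilt_greatest) (simp add: algebra_simps)
  then have "tilt q v k (x + y) - tilt q v k x \<le> tilt q v k y"
    by (intro tilt_greatest) (simp add: algebra_simps)
  then show "tilt q v k (x + y) \<le> tilt q v k x + tilt q v k y" by simp
next
  fix c :: real and x
  assume c: "0 < c"
  have "tilt q v k (c *\<^sub>R x) / c \<le> q (x + d *\<^sub>R v) - d * k" if "0 \<le> d" for d
    using tilt_lower[of "c * d" "c *\<^sub>R x"] that c sublinear_scale[OF q, of c "x + d *\<^sub>R v"]
    by (simp add: field_simps scaleR_add_right)
  then have "tilt q v k (c *\<^sub>R x) / c \<le> tilt q v k x" by (rule tilt_greatest)
  then show "tilt q v k (c *\<^sub>R x) \<le> c * tilt q v k x" using c by (simp add: field_simps)
qed

end

text \<open>Subadditivity needs the bound \<open>q x + q' y\<close> for two different members; in a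
  chain the smaller one serves for both. The common bound \<open>r\<close> keeps the infima finite,
  since \<open>- r (- z) \<le> q z\<close>.\<close>

lemma sublinear_INF_chain:
  assumes C: "C \<noteq> {}" and sub: "\<And>q. q \<in> C \<Longrightarrow> sublinear q \<and> q \<le> r"
    and chain: "\<And>q q'. q \<in> C \<Longrightarrow> q' \<in> C \<Longrightarrow> q \<le> q' \<or> q' \<le> q"
  shows "sublinear (\<lambda>z. INF q\<in>C. q z)" and "\<And>q. q \<in> C \<Longrightarrow> (\<lambda>z. INF q\<in>C. q z) \<le> q"
proof -
  have "- r (- z) \<le> q z" if "q \<in> C" for q z
    using sub[OF that] sublinear_minus[of q z] le_funD[of q r "- z"] by auto
  then have lower: "(INF q\<in>C. q z) \<le> q z" if "q \<in> C" for q z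
    using that by (intro cINF_lower bdd_belowI[of _ "- r (- z)"]) auto
  show "\<And>q. q \<in> C \<Longrightarrow> (\<lambda>z. INF q\<in>C. q z) \<le> q" using lower by (auto simp: le_fun_def)
  have greatest: "b \<le> (INF q\<in>C. q z)" if "\<And>q. q \<in> C \<Longrightarrow> b \<le> q z" for b z
    using C that by (rule cINF_greatest)
  show "sublinear (\<lambda>z. INF q\<in>C. q z)"
  proof (rule sublinearI)
    fix x y
    have "(INF q\<in>C. q (x + y)) \<le> q x + q' y" if qq: "q \<in> C" "q' \<in> C" for q q'
    proof -
      obtain s where s: "s \<in> C" "s \<le> q" "s \<le> q'" using chain[OF qq] qq by blast
      have "(INF q\<in>C. q (x + y)) \<le> s (x + y)" by (rule lower[OF s(1)])
      also have "\<dots> \<le> s x + s y" using sub[OF s(1)] by (simp add: sublinear_add)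
      also have "\<dots> \<le> q x + q' y" using s by (intro add_mono) (auto simp: le_fun_def)
      finally show ?thesis .
    qed
    then have "(INF q\<in>C. q (x + y)) - q' y \<le> (INF q\<in>C. q x)" if "q' \<in> C" for q'
      using that by (intro greatest) (simp add: algebra_simps)
    then have "(INF q\<in>C. q (x + y)) - (INF q\<in>C. q x) \<le> (INF q\<in>C. q y)"
      by (intro greatest) (simp add: algebra_simps)
    then show "(INF q\<in>C. q (x + y)) \<le> (INF q\<in>C. q x) + (INF q\<in>C. q y)" by simp
  next
    fix c :: real and x
    assume c: "0 < c"
    have "(INF q\<in>C. q (c *\<^sub>R x)) / c \<le> q x" if "q \<in> C" for q
      using lower[OF that, of "c *\<^sub>R x"] sub[OF that] c
      by (simp add: sublinear_scale field_simps)
    then have "(INF q\<in>C. q (c *\<^sub>R x)) / c \<le> (INF q\<in>C. q x)" by (rule greatest)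
    then show "(INF q\<in>C. q (c *\<^sub>R x)) \<le> c * (INF q\<in>C. q x)" using c by (simp add: field_simps)
  qed
qed

text \<open>Zorn's lemma for the reversed order: a nonempty chain is bounded by its pointwise
  infimum, the empty chain by \<open>r\<close>.\<close>

lemma exists_minimal_sublinear:
  fixes r :: "'a::real_vector \<Rightarrow> real"
  assumes r: "sublinear r"
  obtains g where "sublinear g" "g \<le> r" "\<And>q. sublinear q \<Longrightarrow> q \<le> g \<Longrightarrow> q = g"
proof -
  let ?Q = "{q. sublinear q \<and> q \<le> r}"
  have "\<exists>g\<in>?Q. \<forall>q\<in>?Q. q \<le> g \<longrightarrow> q = g"
  proof (rule predicate_Zorn[where P = "\<lambda>p q. q \<le> p"])
    show "partial_order_on ?Q (relation_of (\<lambda>p q. q \<le> p) ?Q)"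
      by (rule partial_order_on_relation_ofI) auto
    fix C assume C: "C \<in> Chains (relation_of (\<lambda>p q. q \<le> p) ?Q)"
    then have CQ: "C \<subseteq> ?Q" and chain: "\<And>q q'. q \<in> C \<Longrightarrow> q' \<in> C \<Longrightarrow> q \<le> q' \<or> q' \<le> q"
      unfolding Chains_def relation_of_def by blast+
    show "\<exists>u\<in>?Q. \<forall>a\<in>C. u \<le> a"
    proof (cases "C = {}")
      case True
      then show ?thesis using r by auto
    next
      case False
      have sub: "\<And>q. q \<in> C \<Longrightarrow> sublinear q \<and> q \<le> r" using CQ by blast
      note inf = sublinear_INF_chain[OF False sub chain]
      obtain q where "q \<in> C" using False by blast
      then have "(\<lambda>z. INF q\<in>C. q z) \<le> r" using inf(2) sub order_trans by blast
      then show ?thesis using inf by blast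
    qed
  qed
  then show ?thesis using that by (metis (mono_tags, lifting) mem_Collect_eq order_trans)
qed

text \<open>Minimality yields oddness, and an odd sublinear functional is linear: subadditivity at
  \<open>x + y\<close> and \<open>- y\<close> gives the reverse inequality.\<close>

lemma minimal_sublinear_linear:
  fixes g :: "'a::real_vector \<Rightarrow> real"
  assumes g: "sublinear g" and min: "\<And>q. sublinear q \<Longrightarrow> q \<le> g \<Longrightarrow> q = g"
  shows "linear g"
proof -
  have odd: "g (- x) = - g x" for x
    \<comment> \<open>by minimality, tilting \<open>g\<close> along \<open>x\<close> does not change it\<close>
  proof -
    have "tilt g x (g x) = g"
      using sublinear_tilt[OF g order_refl] tilt_le[OF g order_refl]
      by (intro min) (auto simp: le_fun_def)
    then have "g (- x) \<le> - g x" using tilt_minus[OF g order_refl, of x] by simp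
    with sublinear_minus[OF g, of x] show ?thesis by simp
  qed
  show ?thesis
  proof (rule linearI)
    fix x y
    have "g x \<le> g (x + y) + g (- y)" using sublinear_add[OF g, of "x + y" "- y"] by simp
    with sublinear_add[OF g, of x y] show "g (x + y) = g x + g y" by (simp add: odd)
  next
    fix c x
    show "g (c *\<^sub>R x) = c *\<^sub>R g x"
      using sublinear_scale[OF g, of c x] sublinear_scale[OF g, of "- c" x] odd[of "c *\<^sub>R x"]
      by (cases "0 \<le> c") auto
  qed
qed

text \<open>A minimal sublinear functional below the tilt of \<open>q\<close> along \<open>v\<close>
  is linear, and the bound by the tilt at \<open>- v\<close> forces its value at \<open>v\<close> up
  to \<open>q v\<close>.\<close>

theorem sublinear_Hahn_Banach:
  fixes q :: "'a::real_vector \<Rightarrow> real"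
  assumes q: "sublinear q"
  obtains g where "linear g" "\<And>z. g z \<le> q z" "g v = q v"
proof -
  obtain g where g: "sublinear g" "g \<le> tilt q v (q v)" "\<And>r. sublinear r \<Longrightarrow> r \<le> g \<Longrightarrow> r = g"
    using exists_minimal_sublinear[OF sublinear_tilt[OF q order_refl]] by metis
  have lin: "linear g" using g by (intro minimal_sublinear_linear)
  have le: "g z \<le> q z" for z
    using le_funD[OF g(2), of z] tilt_le[OF q order_refl, of v z] by simp
  have "g (- v) \<le> - q v"
    using le_funD[OF g(2), of "- v"] tilt_minus[OF q order_refl, of v] by simp
  then have "g v = q v" using le[of v] linear_neg[OF lin, of v] by simp
  with lin le show ?thesis by (rule that)
qed

subsection \<open>Support functionals of a semi-norm\<close>

context
  fixes p :: "'a::real_vector \<Rightarrow> real"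
  assumes p: "seminorm_on UNIV p"
begin

lemma seminorm_ge0: "0 \<le> p x"
  and seminorm_add: "p (x + y) \<le> p x + p y"
  and seminorm_scale: "p (c *\<^sub>R x) = \<bar>c\<bar> * p x"
  using p unfolding seminorm_on_def by auto

lemma seminorm_minus: "p (- x) = p x"
  using seminorm_scale[of "-1" x] by simp

lemma seminorm_abs_diff: "\<bar>p x - p y\<bar> \<le> p (x - y)"
  using seminorm_add[of "x - y" y] seminorm_add[of "y - x" x] seminorm_minus[of "x - y"] by simp

lemma sublinear_seminorm: "sublinear p"
  unfolding sublinear_def using seminorm_add seminorm_scale by simp

text \<open>Every linear functional below the tilt of \<open>p\<close> along \<open>w\<close> with
  constant \<open>p w\<close> takes the value \<open>p w\<close> at \<open>w\<close>. One that
  attains the tilt at \<open>v\<close> is chosen, and \<open>dir\<close> makes this value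
  non-negative.\<close>

lemma seminorm_support_functional:
  assumes dir: "\<And>c. 0 \<le> c \<Longrightarrow> p w \<le> p (w + c *\<^sub>R v)"
  obtains g where "linear g" "\<And>z. \<bar>g z\<bar> \<le> p z" "g w = p w" "0 \<le> g v"
proof -
  note sub = sublinear_seminorm
  obtain g where g: "linear g" "\<And>z. g z \<le> tilt p w (p w) z" "g v = tilt p w (p w) v"
    using sublinear_Hahn_Banach[OF sublinear_tilt[OF sub order_refl]] by metis
  \<comment> \<open>For \<open>s > 0\<close> this is \<open>dir\<close> at \<open>c = 1 / s\<close>,
    multiplied by \<open>s\<close>.\<close>
  have "0 \<le> p (v + s *\<^sub>R w) - s * p w" if "0 \<le> s" for s
  proof (cases "s = 0")
    case False
    then have s: "0 < s" using that by simp
    have "s * p w \<le> s * p (w + (1 / s) *\<^sub>R v)" using s by (intro mult_left_mono dir) auto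
    also have "\<dots> = p (s *\<^sub>R (w + (1 / s) *\<^sub>R v))" using s by (simp add: seminorm_scale)
    also have "s *\<^sub>R (w + (1 / s) *\<^sub>R v) = v + s *\<^sub>R w" using s by (simp add: scaleR_add_right)
    finally show ?thesis by simp
  qed (simp add: seminorm_ge0)
  then have "0 \<le> g v" unfolding g(3) by (rule tilt_greatest)
  have le: "g z \<le> p z" for z using g(2)[of z] tilt_le[OF sub order_refl, of w z] by simp
  have "\<bar>g z\<bar> \<le> p z" for z
    using le[of z] le[of "- z"] by (simp add: linear_neg[OF g(1)] seminorm_minus)
  moreover have "g w = p w"
    using le[of w] g(2)[of "- w"] tilt_minus[OF sub order_refl, of w]
    by (simp add: linear_neg[OF g(1)])
  ultimately show ?thesis using that g(1) \<open>0 \<le> g v\<close> by blast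
qed

end

subsection \<open>Representatives and the sets of \<open>\<oplus>\<close> and \<open>\<ominus>\<close>\<close>

lemma representative_scale:
  assumes A: "rho_admissible Z A" and x: "x \<in> Z" "x \<noteq> 0"
  obtains t where "t \<noteq> 0" "representative A x \<in> A" "representative A x = t *\<^sub>R x"
proof -
  have "\<exists>!a. a \<in> A \<and> proj_rel a x" using A x unfolding rho_admissible_def by blast
  then have "representative A x \<in> A \<and> proj_rel (representative A x) x"
    unfolding representative_def by (rule theI')
  then show ?thesis using that unfolding proj_rel_def by blast
qed

lemma ominus_set_iff_oplus_set: "v \<in> ominus_set Ps A p w \<longleftrightarrow> - v \<in> oplus_set Ps A p w"
proof -
  have "(\<exists>f. pb_functional Ps p b f \<and> f (- v) \<ge> 0) \<longleftrightarrow> (\<exists>f. pb_functional Ps p b f \<and> f v \<le> 0)"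
    and "(\<exists>f. pb_functional Ps p b f \<and> f (- v) \<le> 0) \<longleftrightarrow> (\<exists>f. pb_functional Ps p b f \<and> f v \<ge> 0)"
    for b
    unfolding pb_functional_def by (auto simp: linear_neg)
  then show ?thesis unfolding oplus_set_def ominus_set_def by simp
qed

text \<open>With \<open>b = t *\<^sub>R w\<close> and \<open>p b = 1\<close>, functionals normalized
  at \<open>b\<close> correspond to those norming \<open>w\<close> through multiplication by
  \<open>sgn t\<close>, which absorbs the case distinction on the sign. The convention for
  \<open>v = 0\<close> agrees, as a support functional at \<open>w\<close> always exists.\<close>

lemma oplus_set_iff:
  assumes A: "rho_admissible UNIV A" and w: "w \<noteq> 0"
    and p: "p \<in> Ps" "seminorm_on UNIV p" "p (representative A w) = 1"
  shows "v \<in> oplus_set Ps A p w \<longleftrightarrow>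
    (\<exists>g. linear g \<and> (\<forall>z. \<bar>g z\<bar> \<le> p z) \<and> g w = p w \<and> 0 \<le> g v)"
proof -
  define b where "b = representative A w"
  obtain t where t: "t \<noteq> 0" "b = t *\<^sub>R w"
    using representative_scale[OF A UNIV_I w] unfolding b_def by metis
  have w_eq: "w = (1 / t) *\<^sub>R b" using t by simp
  have pw: "p w = 1 / \<bar>t\<bar>" using p(2,3) seminorm_scale[OF p(2), of t w] t
    unfolding b_def by (simp add: field_simps)
  have b0: "b \<noteq> 0" using t w by simp
  have coeff: "w = \<mu> *\<^sub>R b \<longleftrightarrow> \<mu> = 1 / t" for \<mu>
    using b0 by (subst w_eq) auto
  have pb: "pb_functional Ps p b f \<longleftrightarrow> linear f \<and> (\<forall>z. \<bar>f z\<bar> \<le> p z) \<and> f b = 1" for f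
    using p unfolding pb_functional_def unit_seminorms_def b_def by simp
  have fb: "f b = t * f w" if "linear f" for f
    using linear_scale[OF that, of t w] t by simp
  have flip: "linear (\<lambda>z. - f z)" if "linear f" for f :: "'a \<Rightarrow> real"
    using linear_compose_neg[OF that] by simp
  show ?thesis
  proof
    assume "v \<in> oplus_set Ps A p w"
    then consider "v = 0"
      | f where "t > 0" "pb_functional Ps p b f" "f v \<ge> 0"
      | f where "t < 0" "pb_functional Ps p b f" "f v \<le> 0"
      using w t unfolding oplus_set_def b_def[symmetric] mem_Collect_eq coeff by auto
    then show "\<exists>g. linear g \<and> (\<forall>z. \<bar>g z\<bar> \<le> p z) \<and> g w = p w \<and> 0 \<le> g v"
    proof cases
      case 1
      then have "\<And>c. 0 \<le> c \<Longrightarrow> p w \<le> p (w + c *\<^sub>R v)" by simp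
      from seminorm_support_functional[OF p(2) this] show ?thesis by metis
    next
      case 2
      then show ?thesis using fb unfolding pb pw by (intro exI[of _ f]) (auto simp: field_simps)
    next
      case 3
      then show ?thesis using fb flip unfolding pb pw
        by (intro exI[of _ "\<lambda>z. - f z"]) (auto simp: field_simps)
    qed
  next
    assume "\<exists>g. linear g \<and> (\<forall>z. \<bar>g z\<bar> \<le> p z) \<and> g w = p w \<and> 0 \<le> g v"
    then obtain g where g: "linear g" "\<And>z. \<bar>g z\<bar> \<le> p z" "g w = p w" "0 \<le> g v" by blast
    have gb: "g b = sgn t" using fb[OF g(1)] g(3) pw t(1) by (simp add: sgn_if)
    have "t > 0 \<Longrightarrow> pb_functional Ps p b g" and "t < 0 \<Longrightarrow> pb_functional Ps p b (\<lambda>z. - g z)"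
      unfolding pb using g flip gb by auto
    moreover have "0 < 1 / t \<and> 0 < t \<or> 1 / t < 0 \<and> t < 0" using t(1) by auto
    moreover have "- g v \<le> 0" using g(4) by simp
    ultimately show "v \<in> oplus_set Ps A p w"
      unfolding oplus_set_def b_def[symmetric] mem_Collect_eq coeff
      using g(4) by blast
  qed
qed

subsection \<open>Norming points in a direction\<close>

text \<open>Otherwise each \<open>a\<close> in \<open>K\<close> and each \<open>p\<close> admit some
  \<open>c > 0\<close> with \<open>p (T a + c *\<^sub>R A a) < M\<close>. The sets
  \<open>U n\<close>, where this holds for all \<open>p\<close> at
  \<open>c = 1 / real (Suc n)\<close>, are open, cover \<open>K\<close> and increase on it, so a
  single one contains \<open>K\<close>, against \<open>ge\<close>.\<close>

lemma directional_norming_point: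
  fixes \<tau> :: "'x::real_vector topology" and Ps :: "('y::real_vector \<Rightarrow> real) set"
  assumes Ps: "finite Ps" and sn: "\<And>p. p \<in> Ps \<Longrightarrow> seminorm_on UNIV p"
    and \<tau>: "topspace \<tau> = UNIV" and K: "compactin \<tau> K"
    and T: "T \<in> cont_lin_maps \<tau> (seminorm_topology UNIV Ps)"
    and A: "A \<in> cont_lin_maps \<tau> (seminorm_topology UNIV Ps)"
    and le: "\<And>p a. p \<in> Ps \<Longrightarrow> a \<in> K \<Longrightarrow> p (T a) \<le> M"
    and ge: "\<And>c. 0 < c \<Longrightarrow> \<exists>p\<in>Ps. \<exists>a\<in>K. M \<le> p (T a + c *\<^sub>R A a)"
  obtains p a where "p \<in> Ps" "a \<in> K" "p (T a) = M" "\<And>c. 0 \<le> c \<Longrightarrow> M \<le> p (T a + c *\<^sub>R A a)"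
proof -
  let ?\<Gamma> = "seminorm_topology UNIV Ps"
  have "\<exists>p\<in>Ps. \<exists>a\<in>K. \<forall>c>0. M \<le> p (T a + c *\<^sub>R A a)"
  proof (rule ccontr)
    assume "\<not> ?thesis"
    then have small: "\<exists>c>0. p (T a + c *\<^sub>R A a) < M" if "p \<in> Ps" "a \<in> K" for p a
      using that by force
    have mono: "p (T a + d *\<^sub>R A a) < M"
      if "p \<in> Ps" "a \<in> K" "0 < d" "d \<le> c" "p (T a + c *\<^sub>R A a) < M" for p a c d
    proof -
      note p = sn[OF that(1)]
      have c: "0 < c" using that by simp
      \<comment> \<open>The strict bound at \<open>c\<close> passes to \<open>d\<close> by
        convexity; it stays strict because the weight \<open>d / c\<close> is positive.\<close>
      have "T a + d *\<^sub>R A a = (1 - d / c) *\<^sub>R T a + (d / c) *\<^sub>R (T a + c *\<^sub>R A a)"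
        using c by (simp add: algebra_simps)
      then have "p (T a + d *\<^sub>R A a)
          \<le> p ((1 - d / c) *\<^sub>R T a) + p ((d / c) *\<^sub>R (T a + c *\<^sub>R A a))"
        using seminorm_add[OF p] by metis
      also have "\<dots> = (1 - d / c) * p (T a) + (d / c) * p (T a + c *\<^sub>R A a)"
        using that c by (simp add: seminorm_scale[OF p])
      also have "\<dots> < (1 - d / c) * M + (d / c) * M"
        using that c le by (intro add_le_less_mono mult_left_mono mult_strict_left_mono) auto
      also have "\<dots> = M" by (simp add: algebra_simps)
      finally show ?thesis .
    qed
    define U where
      "U n = {x. \<forall>p\<in>Ps. p (T x + (1 / real (Suc n)) *\<^sub>R A x) < M}" for n
    have "openin \<tau> (U n)" for n
    proof -
      have "T + (1 / real (Suc n)) *\<^sub>R A \<in> cont_lin_maps \<tau> ?\<Gamma>"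
        using subspace_cont_lin_maps[OF Ps sn \<tau>] T A by (simp add: subspace_add subspace_scale)
      then have "continuous_map \<tau> ?\<Gamma> (\<lambda>x. T x + (1 / real (Suc n)) *\<^sub>R A x)"
        unfolding cont_lin_maps_def plus_fun_def scaleR_fun_def by blast
      moreover have "continuous_map ?\<Gamma> euclideanreal p" if "p \<in> Ps" for p
        by (rule continuous_map_seminorm_topology[OF subspace_UNIV Ps sn _ that])
          (auto intro: seminorm_abs_diff[OF sn[OF that]])
      ultimately have cont: "continuous_map \<tau> euclideanreal
          (\<lambda>x. p (T x + (1 / real (Suc n)) *\<^sub>R A x))" if "p \<in> Ps" for p
        using continuous_map_compose[of \<tau> ?\<Gamma> _ euclideanreal p] that by (auto simp: o_def)
      have "openin \<tau> {x. p (T x + (1 / real (Suc n)) *\<^sub>R A x) < M}" if "p \<in> Ps" for p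
        using openin_continuous_map_preimage[OF cont[OF that], of "{..<M}"] \<tau> by simp
      then have "openin \<tau> (topspace \<tau> \<inter>
          (\<Inter>p\<in>Ps. {x. p (T x + (1 / real (Suc n)) *\<^sub>R A x) < M}))"
        using Ps by (intro openin_Int_Inter) auto
      also have "topspace \<tau> \<inter> (\<Inter>p\<in>Ps. {x. p (T x + (1 / real (Suc n)) *\<^sub>R A x) < M}) = U n"
        using \<tau> unfolding U_def by auto
      finally show ?thesis .
    qed
    moreover have U_mono: "a \<in> U n" if "a \<in> K" "a \<in> U k" "k \<le> n" for a k n
      unfolding U_def
    proof (intro CollectI ballI)
      fix p assume p: "p \<in> Ps"
      have "1 / real (Suc n) \<le> 1 / real (Suc k)" using that by (intro divide_left_mono) auto
      with mono[OF p \<open>a \<in> K\<close> _ this] that p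
      show "p (T a + (1 / real (Suc n)) *\<^sub>R A a) < M" unfolding U_def by auto
    qed
    moreover have "K \<subseteq> \<Union> (range U)"
    proof
      fix a assume a: "a \<in> K"
      obtain c where c: "\<And>p. p \<in> Ps \<Longrightarrow> c p > 0 \<and> p (T a + c p *\<^sub>R A a) < M"
        using small[OF _ a] by metis
      \<comment> \<open>The element 1 keeps the set nonempty; for parameters below \<open>e\<close>
        all semi-norms are below \<open>M\<close> at once by \<open>mono\<close>.\<close>
      define e where "e = Min (insert 1 (c ` Ps))"
      have "e > 0" unfolding e_def using Ps c by auto
      then obtain n where n: "1 / real (Suc n) < e" using nat_approx_posE by metis
      have "p (T a + (1 / real (Suc n)) *\<^sub>R A a) < M" if "p \<in> Ps" for p
      proof -
        have "e \<le> c p" unfolding e_def using Ps that by simp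
        then show ?thesis using mono[OF that a, of "1 / real (Suc n)" "c p"] c[OF that] n by simp
      qed
      then show "a \<in> \<Union> (range U)" unfolding U_def by blast
    qed
    ultimately obtain \<F> where "finite \<F>" "\<F> \<subseteq> range U" "K \<subseteq> \<Union>\<F>"
      using compactinD[OF K, of "range U"] by blast
    then obtain J where J: "finite J" "K \<subseteq> \<Union> (U ` J)" by (metis finite_subset_image)
    obtain N where "\<And>n. n \<in> J \<Longrightarrow> n \<le> N" using J(1) Max_ge by blast
    then have "K \<subseteq> U N" using J(2) U_mono by blast
    moreover obtain p a where "p \<in> Ps" "a \<in> K" "M \<le> p (T a + (1 / real (Suc N)) *\<^sub>R A a)"
      using ge[of "1 / real (Suc N)"] by auto
    ultimately show False unfolding U_def by force
  qed
  then obtain p a where pa: "p \<in> Ps" "a \<in> K" and pos: "\<And>c. 0 < c \<Longrightarrow> M \<le> p (T a + c *\<^sub>R A a)"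
    by blast
  note p = sn[OF pa(1)]
  \<comment> \<open>This lets \<open>c\<close> tend to 0 in \<open>pos\<close>; the added 1 keeps
    the denominator of \<open>c\<close> positive.\<close>
  have "M \<le> p (T a) + e" if e: "0 < e" for e
  proof -
    define c where "c = e / (p (A a) + 1)"
    have d: "0 < p (A a) + 1" using seminorm_ge0[OF p, of "A a"] by simp
    then have c: "0 < c" unfolding c_def using e by simp
    have "M \<le> p (T a + c *\<^sub>R A a)" by (rule pos[OF c])
    also have "\<dots> \<le> p (T a) + c * p (A a)"
      using seminorm_add[OF p, of "T a" "c *\<^sub>R A a"] c by (simp add: seminorm_scale[OF p])
    also have "c * p (A a) \<le> c * (p (A a) + 1)" using c by simp
    also have "\<dots> = e" using d unfolding c_def by simp
    finally show ?thesis by simp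
  qed
  then have "M \<le> p (T a)" by (rule field_le_epsilon)
  with le[OF pa] have eq: "p (T a) = M" by simp
  have "M \<le> p (T a + c *\<^sub>R A a)" if "0 \<le> c" for c
    using pos[of c] that eq by (cases "c = 0") auto
  with pa eq show ?thesis by (rule that)
qed

subsection \<open>Orthogonality through the dual sphere\<close>

text \<open>The representative of \<open>T\<close> is \<open>t *\<^sub>R T\<close> with
  \<open>\<bar>t\<bar> * P T = 1\<close>. For \<open>F\<close> in the dual sphere the supremum of
  \<open>\<bar>F z\<bar>\<close> over \<open>A\<^sub>L\<close> is 1, so attaining it there means
  \<open>F (t *\<^sub>R T) = 1\<close>, and multiplication by \<open>sgn t\<close> passes between
  this and \<open>F T = P T\<close>.\<close>

lemma orthogonal_dual_sphere_iff:
  assumes L: "subspace L" and P: "seminorm_on L P" and A\<^sub>L: "rho_admissible L A\<^sub>L"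
    and unit: "\<And>S. S \<in> A\<^sub>L \<Longrightarrow> P S \<in> {0, 1}"
    and T: "T \<in> L" "P T \<noteq> 0" and A: "A \<in> L" "A \<noteq> 0"
  shows "orthogonal_wrt (seminorm_topology L {P}) (dual_sphere L P A\<^sub>L) A\<^sub>L T A \<longleftrightarrow>
    (\<exists>F. linear_functional_on L F \<and> (\<forall>S\<in>L. \<bar>F S\<bar> \<le> P S) \<and> F T = P T \<and> F A = 0)"
proof -
  have T0: "T \<noteq> 0" using T seminorm_on_zero[OF P T(1)] by auto
  obtain t where t: "t \<noteq> 0" "representative A\<^sub>L T \<in> A\<^sub>L" "representative A\<^sub>L T = t *\<^sub>R T"
    using representative_scale[OF A\<^sub>L T(1) T0] .
  obtain s where s: "s \<noteq> 0" "representative A\<^sub>L A = s *\<^sub>R A"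
    using representative_scale[OF A\<^sub>L A] by metis
  have PT: "0 < P T" using T P unfolding seminorm_on_def by (auto simp: less_le)
  have scale: "P (c *\<^sub>R S) = \<bar>c\<bar> * P S" if "S \<in> L" for c S
    using P that unfolding seminorm_on_def by blast
  have PtT: "\<bar>t\<bar> * P T = 1"
    using unit[OF t(2)] t T scale[OF T(1), of t] by auto
  have A\<^sub>L_sub: "A\<^sub>L \<subseteq> L" using A\<^sub>L unfolding rho_admissible_def by blast
  show ?thesis
  proof
    assume "orthogonal_wrt (seminorm_topology L {P}) (dual_sphere L P A\<^sub>L) A\<^sub>L T A"
    then obtain F where F: "F \<in> dual_sphere L P A\<^sub>L" and bdd: "bdd_above ((\<lambda>z. \<bar>F z\<bar>) ` A\<^sub>L)"
      and sup: "F (t *\<^sub>R T) = (SUP z\<in>A\<^sub>L. \<bar>F z\<bar>)" and van: "\<And>c. F (c *\<^sub>R s *\<^sub>R A) = 0"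
      using T0 A t s unfolding orthogonal_wrt_def orthogonal_repr_def by auto
    have lin: "linear_functional_on L F" and dom: "\<And>S. S \<in> L \<Longrightarrow> \<bar>F S\<bar> \<le> P S"
      using F unfolding dual_sphere_def by auto
    have hom: "F (c *\<^sub>R S) = c * F S" if "S \<in> L" for c S
      using lin that unfolding linear_functional_on_def by blast
    \<comment> \<open>The normalizing element \<open>R\<close> may be the negative of one in
      \<open>A\<^sub>L\<close>; absolute values do not notice this, so the supremum is at least
      1.\<close>
    obtain R where R: "R \<in> A\<^sub>L \<union> uminus ` A\<^sub>L" "F R = 1" using F unfolding dual_sphere_def by auto
    obtain S where S: "S \<in> A\<^sub>L" "R = S \<or> R = - S" using R(1) by auto
    have "\<bar>F S\<bar> = 1" using S R(2) hom[of S "-1"] A\<^sub>L_sub by auto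
    then have "1 \<le> F (t *\<^sub>R T)" unfolding sup using S(1) bdd by (metis cSUP_upper)
    moreover have "\<bar>F (t *\<^sub>R T)\<bar> \<le> 1"
      using dom[of "t *\<^sub>R T"] T L PtT scale[OF T(1)] by (simp add: subspace_scale)
    ultimately have "t * F T = 1" using hom[OF T(1)] by simp
    then have "F T = 1 / t" using t(1) by (simp add: field_simps)
    moreover have "P T = 1 / \<bar>t\<bar>" using PtT t(1) by (simp add: field_simps)
    ultimately have "sgn t * F T = P T" using t(1) by (simp add: sgn_if)
    moreover have "F A = 0" using van[of "1 / s"] s by simp
    moreover have "linear_functional_on L (\<lambda>S. sgn t * F S)"
      using lin unfolding linear_functional_on_def by (simp add: algebra_simps)
    ultimately show "\<exists>F. linear_functional_on L F \<and> (\<forall>S\<in>L. \<bar>F S\<bar> \<le> P S) \<and> F T = P T \<and> F A = 0"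
      using dom t(1)
      by (intro exI[of _ "\<lambda>S. sgn t * F S"]) (auto simp: abs_mult sgn_if)
  next
    assume "\<exists>F. linear_functional_on L F \<and> (\<forall>S\<in>L. \<bar>F S\<bar> \<le> P S) \<and> F T = P T \<and> F A = 0"
    then obtain F where lin: "linear_functional_on L F" and dom: "\<And>S. S \<in> L \<Longrightarrow> \<bar>F S\<bar> \<le> P S"
      and FT: "F T = P T" and FA: "F A = 0" by blast
    define G where "G S = sgn t * F S" for S
    have Glin: "linear_functional_on L G"
      using lin unfolding linear_functional_on_def G_def by (simp add: algebra_simps)
    have Gdom: "\<bar>G S\<bar> \<le> P S" if "S \<in> L" for S
      using dom[OF that] t(1) unfolding G_def by (simp add: abs_mult sgn_if)
    have hom: "G (c *\<^sub>R S) = c * G S" if "S \<in> L" for c S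
      using Glin that unfolding linear_functional_on_def by blast
    have GtT: "G (t *\<^sub>R T) = 1"
      using hom[OF T(1), of t] PtT t(1) FT unfolding G_def by (auto simp: sgn_if abs_if split: if_splits)
    have GA: "G (c *\<^sub>R s *\<^sub>R A) = 0" for c
      using hom[OF A(1), of "c * s"] FA unfolding G_def by simp
    \<comment> \<open>The representative of \<open>T\<close> itself witnesses the
      normalization.\<close>
    have Gds: "G \<in> dual_sphere L P A\<^sub>L"
      unfolding dual_sphere_def using Glin Gdom t PtT GtT scale[OF T(1), of t] by force
    have le1: "\<bar>G S\<bar> \<le> 1" if "S \<in> A\<^sub>L" for S
      using Gdom[of S] unit[OF that] that A\<^sub>L_sub by auto
    have sup: "(SUP z\<in>A\<^sub>L. \<bar>G z\<bar>) = 1"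
      by (rule cSup_eq_maximum) (use le1 t GtT in force)+
    have "bdd_above ((\<lambda>z. \<bar>G z\<bar>) ` A\<^sub>L)" using le1 by (intro bdd_aboveI[of _ 1]) auto
    then show "orthogonal_wrt (seminorm_topology L {P}) (dual_sphere L P A\<^sub>L) A\<^sub>L T A"
      unfolding orthogonal_wrt_def orthogonal_repr_def t(3) s(2)
      using Gds dual_sphere_continuous[OF L P Gds] sup GtT GA by auto
  qed
qed

section \<open>Evaluation functionals and convex combinations\<close>

lemma linear_functional_on_evaluation: "linear g \<Longrightarrow> linear_functional_on L (\<lambda>S. g (S x))"
  unfolding linear_functional_on_def
  by (simp add: plus_fun_def scaleR_fun_def linear_add linear_scale)

lemma linear_functional_on_convex:
  "linear_functional_on L F \<Longrightarrow> linear_functional_on L G \<Longrightarrow>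
    linear_functional_on L (\<lambda>S. (1 - s) * F S + s * G S)"
  unfolding linear_functional_on_def by (simp add: algebra_simps)

lemma exists_annihilating_convex_combination:
  fixes F G :: "'z::real_vector \<Rightarrow> real"
  assumes F: "linear_functional_on L F" "\<And>S. S \<in> L \<Longrightarrow> \<bar>F S\<bar> \<le> P S" "F T = P T" "0 \<le> F A"
    and G: "linear_functional_on L G" "\<And>S. S \<in> L \<Longrightarrow> \<bar>G S\<bar> \<le> P S" "G T = P T" "G A \<le> 0"
  shows "\<exists>H. linear_functional_on L H \<and> (\<forall>S\<in>L. \<bar>H S\<bar> \<le> P S) \<and> H T = P T \<and> H A = 0"
proof -
  \<comment> \<open>The weight solves the equation \<open>sA\<close>: for
    \<open>F A \<noteq> 0\<close> the signs make the denominator positive, and otherwise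
    \<open>F\<close> itself serves.\<close>
  define s where "s = (if F A = 0 then 0 else F A / (F A - G A))"
  have s: "0 \<le> s" "s \<le> 1" and sA: "(1 - s) * F A + s * G A = 0"
    using F(4) G(4) unfolding s_def by (auto simp: field_simps)
  have "\<bar>(1 - s) * F S + s * G S\<bar> \<le> P S" if "S \<in> L" for S
  proof -
    have "\<bar>(1 - s) * F S + s * G S\<bar> \<le> (1 - s) * \<bar>F S\<bar> + s * \<bar>G S\<bar>"
      using s abs_triangle_ineq[of "(1 - s) * F S" "s * G S"] by (simp add: abs_mult)
    also have "\<dots> \<le> (1 - s) * P S + s * P S"
      using s F(2) G(2) that by (intro add_mono mult_left_mono) auto
    finally show ?thesis by (simp add: algebra_simps)
  qed
  then show ?thesis
    using linear_functional_on_convex[OF F(1) G(1), of s] F(3) G(3) sA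
    by (intro exI[of _ "\<lambda>S. (1 - s) * F S + s * G S"]) (auto simp: algebra_simps)
qed

section \<open>Orthogonality of operators in terms of norming points\<close>

theorem theorem3p4:
  fixes \<tau> :: "'x::real_vector topology"
    and A\<^sub>X \<A> :: "'x set"
    and m :: nat
    and pfam :: "nat \<Rightarrow> 'y::real_vector \<Rightarrow> real"
    and Ps :: "('y \<Rightarrow> real) set"
    and \<Gamma> :: "'y topology"
    and A\<^sub>Y :: "'y set"
    and L A\<^sub>L :: "('x \<Rightarrow> 'y) set"
    and P :: "('x \<Rightarrow> 'y) \<Rightarrow> real"
    and T A :: "'x \<Rightarrow> 'y"
  assumes fin_dim: "\<exists>B :: 'x set. finite B \<and> span B = UNIV"
    and dim_gt_1: "dim (UNIV :: 'x set) > 1"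
    and topspace_\<tau>: "topspace \<tau> = UNIV"
    and A\<^sub>X: "rho_admissible UNIV A\<^sub>X"
    and \<A>_def: "\<A> = A\<^sub>X \<union> uminus ` A\<^sub>X"
    and compact_\<A>: "compactin \<tau> \<A>"
    and m: "m \<ge> 1"
    and seminorms: "\<And>i. i \<in> {1..m} \<Longrightarrow> seminorm_on UNIV (pfam i)"
    and nontrivial: "\<And>i. i \<in> {1..m} \<Longrightarrow> \<exists>y. pfam i y \<noteq> 0"
    and Ps_def: "Ps = pfam ` {1..m}"
    and \<Gamma>_def: "\<Gamma> = seminorm_topology UNIV Ps"
    and A\<^sub>Y: "rho_admissible UNIV A\<^sub>Y"
    and A\<^sub>Y_unit: "\<And>b. b \<in> A\<^sub>Y \<union> uminus ` A\<^sub>Y \<Longrightarrow> (MAX i\<in>{1..m}. pfam i b) \<in> {0, 1}"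
    and L_def: "L = cont_lin_maps \<tau> \<Gamma>"
    and P_def: "P = induced_seminorm \<A> Ps"
    and A\<^sub>L: "rho_admissible L A\<^sub>L"
    and A\<^sub>L_unit: "\<And>S. S \<in> A\<^sub>L \<union> uminus ` A\<^sub>L \<Longrightarrow> P S \<in> {0, 1}"
    and T: "T \<in> L" and A: "A \<in> L"
    and PT: "P T \<noteq> 0"
  shows "orthogonal_wrt (seminorm_topology L {P}) (dual_sphere L P A\<^sub>L) A\<^sub>L T A \<longleftrightarrow>
    (\<exists>x \<in> norming_points \<A> Ps T. \<exists>y \<in> norming_points \<A> Ps T.
     \<exists>p \<in> norming_seminorms \<A> Ps T. \<exists>q \<in> norming_seminorms \<A> Ps T.
       p (T x) = P T \<and> q (T y) = P T \<and>
       A x \<in> oplus_set Ps A\<^sub>Y p (T x) \<and> A y \<in> ominus_set Ps A\<^sub>Y q (T y))"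
proof -
  have Ps: "finite Ps" "Ps \<noteq> {}" using m unfolding Ps_def by auto
  have sn: "seminorm_on UNIV p" if "p \<in> Ps" for p using that seminorms unfolding Ps_def by auto
  \<comment> \<open>The representative of a non-zero vector makes \<open>\<A>\<close> nonempty, as
    the attainment of suprema over it requires.\<close>
  have "\<exists>x::'x. x \<noteq> 0"
  proof (rule ccontr)
    assume "\<not> ?thesis"
    then have "(UNIV :: 'x set) \<subseteq> span {}" by auto
    then have "dim (UNIV :: 'x set) \<le> card ({} :: 'x set)" by (rule dim_le_card) simp
    with dim_gt_1 show False by simp
  qed
  then obtain x0 :: 'x where "x0 \<noteq> 0" by blast
  then have \<A>_ne: "\<A> \<noteq> {}"
    using representative_scale[OF A\<^sub>X UNIV_I] unfolding \<A>_def by blast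
  note L = L_def[unfolded \<Gamma>_def]
  have sub: "subspace L" unfolding L by (rule subspace_cont_lin_maps[OF Ps(1) sn topspace_\<tau>])
  have P_sn: "seminorm_on L P"
    unfolding L P_def by (rule seminorm_on_induced_seminorm[OF Ps sn compact_\<A> \<A>_ne topspace_\<tau>])
  have att: "\<exists>p\<in>Ps. \<exists>a\<in>\<A>. P S = p (S a)" if "S \<in> L" for S
    using induced_seminorm_attained(1)[OF Ps sn compact_\<A> \<A>_ne] that unfolding L P_def by blast
  have le: "p (S a) \<le> P S" if "S \<in> L" "p \<in> Ps" "a \<in> \<A>" for S p a
    using induced_seminorm_attained(2)[OF Ps sn compact_\<A> \<A>_ne] that unfolding L P_def by blast

  have oplus: "v \<in> oplus_set Ps A\<^sub>Y p (T x) \<longleftrightarrow>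
      (\<exists>g. linear g \<and> (\<forall>z. \<bar>g z\<bar> \<le> p z) \<and> g (T x) = P T \<and> 0 \<le> g v)"
    if x: "x \<in> \<A>" and p: "p \<in> Ps" and eq: "p (T x) = P T" for x p v
  proof -
    have p0: "p 0 = 0" using seminorm_on_zero[OF sn[OF p], of 0] by simp
    then have Tx: "T x \<noteq> 0" using eq PT by auto
    obtain t where t: "t \<noteq> 0" "representative A\<^sub>Y (T x) \<in> A\<^sub>Y"
      "representative A\<^sub>Y (T x) = t *\<^sub>R T x"
      using representative_scale[OF A\<^sub>Y UNIV_I Tx] .
    let ?b = "representative A\<^sub>Y (T x)"
    \<comment> \<open>Since \<open>p\<close> attains \<open>P T\<close> at \<open>x\<close>, it
      dominates all other semi-norms at \<open>T x\<close> and its multiples; the maximum in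
      \<open>A\<^sub>Y_unit\<close> is therefore \<open>p ?b\<close>, which must be 1.\<close>
    have "q ?b \<le> p ?b" if "q \<in> Ps" for q
      using le[OF T that x] eq unfolding t(3) seminorm_scale[OF sn[OF that]] seminorm_scale[OF sn[OF p]]
      by (simp add: mult_left_mono)
    then have "(MAX i\<in>{1..m}. pfam i ?b) = p ?b"
      using p unfolding Ps_def by (intro Max_eqI) auto
    then have "p ?b \<in> {0, 1}" using A\<^sub>Y_unit[of ?b] t(2) by auto
    moreover have "p ?b \<noteq> 0" using t eq PT seminorm_scale[OF sn[OF p]] by simp
    ultimately have "p ?b = 1" by blast
    from oplus_set_iff[OF A\<^sub>Y Tx p sn[OF p] this] show ?thesis unfolding eq .
  qed

  let ?R = "\<exists>x \<in> norming_points \<A> Ps T. \<exists>y \<in> norming_points \<A> Ps T.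
     \<exists>p \<in> norming_seminorms \<A> Ps T. \<exists>q \<in> norming_seminorms \<A> Ps T.
       p (T x) = P T \<and> q (T y) = P T \<and>
       A x \<in> oplus_set Ps A\<^sub>Y p (T x) \<and> A y \<in> ominus_set Ps A\<^sub>Y q (T y)"
  \<comment> \<open>The norming equations already place the points and semi-norms in the norming
    sets, so the statement splits into a condition on \<open>A\<close> and the same condition on
    \<open>- A\<close>.\<close>
  have R: "?R \<longleftrightarrow>
      (\<exists>x\<in>\<A>. \<exists>p\<in>Ps. p (T x) = P T \<and> A x \<in> oplus_set Ps A\<^sub>Y p (T x)) \<and>
      (\<exists>y\<in>\<A>. \<exists>q\<in>Ps. q (T y) = P T \<and> - A y \<in> oplus_set Ps A\<^sub>Y q (T y))"
    unfolding norming_points_def norming_seminorms_def P_def[symmetric]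
      ominus_set_iff_oplus_set by (auto; metis)

  \<comment> \<open>The inequality \<open>BJ\<close> is Birkhoff-James orthogonality of
    \<open>T\<close> to \<open>B\<close> in the semi-norm \<open>P\<close>.\<close>
  have BJ_R: "\<exists>x\<in>\<A>. \<exists>p\<in>Ps. p (T x) = P T \<and> B x \<in> oplus_set Ps A\<^sub>Y p (T x)"
    if B: "B \<in> L" and BJ: "\<And>c. P T \<le> P (T + c *\<^sub>R B)" for B
  proof -
    have ge: "\<exists>p\<in>Ps. \<exists>a\<in>\<A>. P T \<le> p (T a + c *\<^sub>R B a)" for c
    proof -
      have "T + c *\<^sub>R B \<in> L" using T B sub by (simp add: subspace_add subspace_scale)
      then obtain p a where "p \<in> Ps" "a \<in> \<A>" "P (T + c *\<^sub>R B) = p ((T + c *\<^sub>R B) a)"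
        using att by blast
      then show ?thesis using BJ[of c] by (auto simp: plus_fun_def scaleR_fun_def)
    qed
    obtain p a where pa: "p \<in> Ps" "a \<in> \<A>" "p (T a) = P T"
      and dir: "\<And>c. 0 \<le> c \<Longrightarrow> P T \<le> p (T a + c *\<^sub>R B a)"
      by (rule directional_norming_point[OF Ps(1) sn topspace_\<tau> compact_\<A>
            T[unfolded L] B[unfolded L], of "P T"])
        (use le[OF T] ge in blast)+
    obtain g where "linear g" "\<And>z. \<bar>g z\<bar> \<le> p z" "g (T a) = p (T a)" "0 \<le> g (B a)"
      using seminorm_support_functional[OF sn[OF pa(1)]] dir pa(3) by metis
    then have "B a \<in> oplus_set Ps A\<^sub>Y p (T a)" unfolding oplus[OF pa(2,1,3)] pa(3) by blast
    then show ?thesis using pa by blast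
  qed

  \<comment> \<open>The functional \<open>g\<close> supporting \<open>p\<close> at
    \<open>T x\<close> is pulled back along evaluation at \<open>x\<close>; since \<open>x\<close>
    lies in \<open>\<A>\<close>, the result is dominated by \<open>P\<close>.\<close>
  have R_F: "\<exists>F. linear_functional_on L F \<and> (\<forall>S\<in>L. \<bar>F S\<bar> \<le> P S) \<and> F T = P T \<and> 0 \<le> F B"
    if "\<exists>x\<in>\<A>. \<exists>p\<in>Ps. p (T x) = P T \<and> B x \<in> oplus_set Ps A\<^sub>Y p (T x)" for B
  proof -
    obtain x p g where xp: "x \<in> \<A>" "p \<in> Ps" and g: "linear g" "\<And>z. \<bar>g z\<bar> \<le> p z"
      "g (T x) = P T" "0 \<le> g (B x)"
      using \<open>\<exists>x\<in>\<A>. _ x\<close> oplus by metis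
    have "\<bar>g (S x)\<bar> \<le> P S" if "S \<in> L" for S
      using g(2)[of "S x"] le[OF that xp(2,1)] by simp
    then show ?thesis using linear_functional_on_evaluation[OF g(1)] g(3,4)
      by (intro exI[of _ "\<lambda>S. g (S x)"]) simp
  qed

  show ?thesis
  proof
    assume orth: "orthogonal_wrt (seminorm_topology L {P}) (dual_sphere L P A\<^sub>L) A\<^sub>L T A"
    have BJ: "P T \<le> P (T + c *\<^sub>R A)" for c
    proof (cases "A = 0")
      case False
      obtain F where F: "linear_functional_on L F" "\<And>S. S \<in> L \<Longrightarrow> \<bar>F S\<bar> \<le> P S" "F T = P T" "F A = 0"
        using orth orthogonal_dual_sphere_iff[OF sub P_sn A\<^sub>L A\<^sub>L_unit[OF UnI1] T PT A False] by blast
      have cA: "c *\<^sub>R A \<in> L" using sub A by (rule subspace_scale)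
      have "F (T + c *\<^sub>R A) = P T"
        using F(1,3,4) T A cA unfolding linear_functional_on_def by simp
      then show ?thesis using F(2)[of "T + c *\<^sub>R A"] subspace_add[OF sub T cA] by simp
    qed simp
    have "P T \<le> P (T + c *\<^sub>R (- A))" for c using BJ[of "- c"] by simp
    then show ?R using BJ_R[OF A BJ] BJ_R[OF subspace_neg[OF sub A]] unfolding R
      by (simp add: fun_Compl_def)
  next
    assume ?R
    then obtain F G where F: "linear_functional_on L F" "\<And>S. S \<in> L \<Longrightarrow> \<bar>F S\<bar> \<le> P S" "F T = P T" "0 \<le> F A"
      and G: "linear_functional_on L G" "\<And>S. S \<in> L \<Longrightarrow> \<bar>G S\<bar> \<le> P S" "G T = P T" "0 \<le> G (- A)"
      using R_F[of A] R_F[of "- A"] unfolding R by (auto simp: fun_Compl_def)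
    have "G (- A) = - G A" using G(1) A unfolding linear_functional_on_def by (metis mult_minus1 scaleR_minus1_left)
    then have "\<exists>H. linear_functional_on L H \<and> (\<forall>S\<in>L. \<bar>H S\<bar> \<le> P S) \<and> H T = P T \<and> H A = 0"
      using F G by (intro exists_annihilating_convex_combination[of L F P T A G]) auto
    \<comment> \<open>For \<open>A = 0\<close> orthogonality holds by convention, outside the scope
      of the functional criterion.\<close>
    then show "orthogonal_wrt (seminorm_topology L {P}) (dual_sphere L P A\<^sub>L) A\<^sub>L T A"
      using orthogonal_dual_sphere_iff[OF sub P_sn A\<^sub>L A\<^sub>L_unit[OF UnI1] T PT A]
      by (cases "A = 0") (auto simp: orthogonal_wrt_def)
  qed
qed

end
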